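(* In the codimension-one setting described in the context, suppose that $\mathrm{vol}(A)=\sum_{i=1}^k\ell_i$ and that $\beta\in V_{\mathbb{C}}$ is nonresonant. The $A$-hypergeometric system with parameter $\beta$ has maximal unipotent monodromy at the origin if and only if $E'_\beta$ is a singleton.
   Context: Setting: $A=\{\mathbf{a}_1,\dots,\mathbf{a}_n\}\subseteq\mathbb{Z}^d$, $V\subseteq\mathbb{R}^d$ is the real span of $A$, $V_{\mathbb{C}}\subseteq\mathbb{C}^d$ its complex span, $\mathbb{Z}A$ the abelian group generated by $A$. It is assumed that $\dim V=n-1$ and that each subset of $A$ of cardinality $n-1$ is linearly independent. The lattice of integer relations on $A$ is generated by a single relation $\sum_{i=1}^k \ell_i\mathbf{a}_i-\sum_{j=k+1}^n\ell_j\mathbf{a}_j=\mathbf{0}$, where $1\le k\le n$ and $\ell_1,\dots,\ell_n$ are relatively prime positive integers. Put $\ell=(\ell_1,\dots,\ell_k,-\ell_{k+1},\dots,-\ell_n)$, $L=\mathbb{Z}\ell$, $x_0=\prod_{i=1}^kx_i^{\ell_i}/\prod_{j=k+1}^nx_j^{\ell_j}$, and $x^w=\prod_\mu x_\mu^{w_\mu}$ for $w\in\mathbb{C}^n$. $\mathrm{vol}(A)$ is the volume of the convex hull of $A\cup\{\mathbf{0}\}$ with respect to Lebesgue measure on $V$ normalized so that the convex hull of the origin and a basis of $\mathbb{Z}A$ has volume $1$. The $A$-hypergeometric system with parameter $\beta=(\beta_1,\dots,\beta_d)$ consists of the box operators $\Box_l=\prod_{l_j>0}\partial_j^{l_j}-\prod_{l_j<0}\partial_j^{-l_j}$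 for $l\in L$, and the Euler operators $\sum_{j=1}^n a_{ij}x_j\partial_j-\beta_i$ for $i=1,\dots,d$, where $\mathbf{a}_j=(a_{1j},\dots,a_{dj})$. Nonresonance: for $1\le i\le k<j\le n$, $H_{ij}\subseteq V$ is the hyperplane through the origin containing $A\setminus\{\mathbf{a}_i,\mathbf{a}_j\}$, and $h_{ij}$ is the linear function on $V$ (unique up to sign) vanishing on $H_{ij}$ with $h_{ij}(\mathbb{Z}A)=\mathbb{Z}$, extended $\mathbb{C}$-linearly to $V_{\mathbb{C}}$. $\beta$ is nonresonant if $h_{ij}(\beta)\notin\mathbb{Z}$ for all $1\le i\le k$ and $k+1\le j\le n$. Exponents: for $i\in\{1,\dots,k\}$, $b\in\{0,\dots,\ell_i-1\}$, $v^{(i,b)}\in\mathbb{C}^n$ is the unique vector with $v^{(i,b)}_i=b$ and $\sum_\mu v^{(i,b)}_\mu\mathbf{a}_\mu=\beta$. $E_\beta$ is the set of all $v^{(i,b)}$ and $E'_\beta=\{v\in E_\beta\mid v_i\notin\mathbb{Z}_{<0}\text{ for }i=1,\dots,k\}$. Maximal unipotent monodromy at the origin means: there are logarithmic solutions involving powers $\log^\mu x_0$ for $\mu=0,1,\dots,\mathrm{vol}(A)-1$, such that the coefficients of the powers of $\log x_0$ are Nilsson series involving only integral powers of $x_0$. Precisely: there is $v\in E'_\beta$ such that for each $\mu=0,1,\dots,\mathrm{vol}(A)-1$ the system has a (formal) solution which is a polynomial of degree exactly $\mu$ in $\log x_0$ with coefficients in $x^v\,\mathbb{C}[[x_0]][x_0^{-1}]$.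 *)

theory Defs
  imports
    "HOL-Analysis.Analysis"
    "HOL-Computational_Algebra.Computational_Algebra"
begin

section \<open>The configuration and its lattices\<close>

text \<open>
  The vectors are given by \<open>a :: nat \<Rightarrow> int ^ 'd\<close>, with \<open>a j\<close> relevant for \<open>j \<in> {1..n}\<close> only.
  \<open>of_int_vec\<close> embeds them into real or complex space.
\<close>

definition of_int_vec :: "int ^ 'd \<Rightarrow> 'b::ring_1 ^ 'd" where
  "of_int_vec z = (\<chi> i. of_int (z $ i))"

definition pts :: "(nat \<Rightarrow> int ^ 'd) \<Rightarrow> nat \<Rightarrow> (real ^ 'd) set" where
  "pts a n = (\<lambda>j. of_int_vec (a j)) ` {1..n}"

definition real_span :: "(nat \<Rightarrow> int ^ 'd) \<Rightarrow> nat \<Rightarrow> (real ^ 'd) set" where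
  "real_span a n = span (pts a n)"

definition complex_span :: "(nat \<Rightarrow> int ^ 'd) \<Rightarrow> nat \<Rightarrow> (complex ^ 'd) set" where
  "complex_span a n = vec.span ((\<lambda>j. of_int_vec (a j)) ` {1..n})"

definition lattice :: "(nat \<Rightarrow> int ^ 'd) \<Rightarrow> nat \<Rightarrow> (real ^ 'd) set" where
  "lattice a n = group_closure (pts a n)"

definition relations :: "(nat \<Rightarrow> int ^ 'd) \<Rightarrow> nat \<Rightarrow> (nat \<Rightarrow> int) set" where
  "relations a n =
     {l. (\<forall>j. j \<notin> {1..n} \<longrightarrow> l j = 0) \<and> (\<Sum>j\<in>{1..n}. l j *s a j) = 0}"

text \<open>The vector \<open>(ell 1, \<dots>, ell k, - ell (k+1), \<dots>, - ell n)\<close>, extended by zero, and its integer multiples.\<close>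

definition signed :: "nat \<Rightarrow> nat \<Rightarrow> (nat \<Rightarrow> nat) \<Rightarrow> nat \<Rightarrow> int" where
  "signed n k ell j =
     (if j \<in> {1..k} then int (ell j) else if j \<in> {k+1..n} then - int (ell j) else 0)"

definition rel_lattice :: "nat \<Rightarrow> nat \<Rightarrow> (nat \<Rightarrow> nat) \<Rightarrow> (nat \<Rightarrow> int) set" where
  "rel_lattice n k ell = range (\<lambda>m j. m * signed n k ell j)"


section \<open>Normalized volume\<close>

definition lattice_basis :: "(nat \<Rightarrow> int ^ 'd) \<Rightarrow> nat \<Rightarrow> (real ^ 'd) set \<Rightarrow> bool" where
  "lattice_basis a n B \<longleftrightarrow> independent B \<and> group_closure B = lattice a n"

text \<open>
  Lebesgue measure on the subspace spanned by the (finite) linearly independent set \<open>B\<close>, as the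
  image of Lebesgue measure on the coordinate space. Another basis of the same subspace changes
  it by a positive factor only.
\<close>

definition subspace_lebesgue :: "(real ^ 'd) set \<Rightarrow> (real ^ 'd) measure" where
  "subspace_lebesgue B = distr (Pi\<^sub>M B (\<lambda>_. lborel)) borel (\<lambda>c. \<Sum>b\<in>B. c b *\<^sub>R b)"

text \<open>The quotient does not depend on the chosen basis of the lattice.\<close>

definition vol :: "(nat \<Rightarrow> int ^ 'd) \<Rightarrow> nat \<Rightarrow> real" where
  "vol a n =
     (let B = (SOME B. lattice_basis a n B)
      in measure (subspace_lebesgue B) (convex hull (insert 0 (pts a n)))
         / measure (subspace_lebesgue B) (convex hull (insert 0 B)))"


section \<open>Nonresonance\<close>

definition hyperplane_omitting ::
    "(nat \<Rightarrow> int ^ 'd) \<Rightarrow> nat \<Rightarrow> nat \<Rightarrow> nat \<Rightarrow> (real ^ 'd) set \<Rightarrow> bool" where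
  "hyperplane_omitting a n i j H \<longleftrightarrow>
     subspace H \<and> H \<subseteq> real_span a n \<and> dim H + 1 = dim (real_span a n) \<and>
     pts a n - {of_int_vec (a i), of_int_vec (a j)} \<subseteq> H"

text \<open>
  Linear functions on the span are represented by linear functions on the whole ambient space;
  only their values on the span are used.
\<close>

definition primitive_functional ::
    "(nat \<Rightarrow> int ^ 'd) \<Rightarrow> nat \<Rightarrow> (real ^ 'd) set \<Rightarrow> (real ^ 'd \<Rightarrow> real) \<Rightarrow> bool" where
  "primitive_functional a n H h \<longleftrightarrow> linear h \<and> (\<forall>x\<in>H. h x = 0) \<and> h ` lattice a n = \<int>"

definition complexify :: "(real ^ 'd \<Rightarrow> real) \<Rightarrow> complex ^ 'd \<Rightarrow> complex" where
  "complexify h z = Complex (h (\<chi> i. Re (z $ i))) (h (\<chi> i. Im (z $ i)))"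

text \<open>
  For given \<open>i\<close> and \<open>j\<close> the hyperplane is unique, and the functional is unique up to sign on the
  span, so the universal quantifiers over \<open>H\<close> and \<open>h\<close> merely name them.
\<close>

definition nonresonant ::
    "(nat \<Rightarrow> int ^ 'd) \<Rightarrow> nat \<Rightarrow> nat \<Rightarrow> complex ^ 'd \<Rightarrow> bool" where
  "nonresonant a n k \<beta> \<longleftrightarrow>
     (\<forall>i\<in>{1..k}. \<forall>j\<in>{k+1..n}. \<forall>H h.
        hyperplane_omitting a n i j H \<longrightarrow> primitive_functional a n H h \<longrightarrow>
        complexify h \<beta> \<notin> \<int>)"


section \<open>Exponents\<close>

text \<open>Vectors in \<open>\<complex>\<^sup>n\<close> are functions on \<open>nat\<close> that vanish outside \<open>{1..n}\<close>.\<close>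

definition exponent ::
    "(nat \<Rightarrow> int ^ 'd) \<Rightarrow> nat \<Rightarrow> complex ^ 'd \<Rightarrow> nat \<Rightarrow> nat \<Rightarrow> nat \<Rightarrow> complex" where
  "exponent a n \<beta> i b =
     (THE v. (\<forall>j. j \<notin> {1..n} \<longrightarrow> v j = 0) \<and> v i = of_nat b \<and>
             (\<Sum>j\<in>{1..n}. v j *s of_int_vec (a j)) = \<beta>)"

definition exponents ::
    "(nat \<Rightarrow> int ^ 'd) \<Rightarrow> nat \<Rightarrow> nat \<Rightarrow> (nat \<Rightarrow> nat) \<Rightarrow> complex ^ 'd \<Rightarrow> (nat \<Rightarrow> complex) set" where
  "exponents a n k ell \<beta> = {exponent a n \<beta> i b | i b. i \<in> {1..k} \<and> b < ell i}"

definition exponents' ::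
    "(nat \<Rightarrow> int ^ 'd) \<Rightarrow> nat \<Rightarrow> nat \<Rightarrow> (nat \<Rightarrow> nat) \<Rightarrow> complex ^ 'd \<Rightarrow> (nat \<Rightarrow> complex) set" where
  "exponents' a n k ell \<beta> =
     {v \<in> exponents a n k ell \<beta>. \<forall>i\<in>{1..k}. v i \<notin> {of_int z | z::int. z < 0}}"


section \<open>Formal logarithmic series and the hypergeometric operators\<close>

text \<open>
  A formal sum of terms \<open>c x\<^sup>w log\<^sup>r x\<^sub>0\<close> is encoded by the function that maps an exponent vector
  \<open>w\<close> to the coefficient of \<open>x\<^sup>w\<close>, which is a polynomial in \<open>log x\<^sub>0\<close>. Here \<open>x\<^sub>0 = x\<^sup>s\<close> for an
  integer vector \<open>s\<close> (the signed relation), so \<open>\<partial>\<^sub>j log x\<^sub>0 = s\<^sub>j x\<^sub>j\<^sup>-\<^sup>1\<close> and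
  \<open>\<partial>\<^sub>j (x\<^sup>w p(log x\<^sub>0)) = x\<^sub>j\<^sup>-\<^sup>1 x\<^sup>w (w\<^sub>j p + s\<^sub>j p')(log x\<^sub>0)\<close>.
\<close>

type_synonym log_series = "(nat \<Rightarrow> complex) \<Rightarrow> complex poly"

definition partial :: "(nat \<Rightarrow> int) \<Rightarrow> nat \<Rightarrow> log_series \<Rightarrow> log_series" where
  "partial s j F = (\<lambda>w. let p = F (w(j := w j + 1))
                        in smult (w j + 1) p + smult (of_int (s j)) (pderiv p))"

definition mult_var :: "nat \<Rightarrow> log_series \<Rightarrow> log_series" where
  "mult_var j F = (\<lambda>w. F (w(j := w j - 1)))"

definition partial_monomial ::
    "(nat \<Rightarrow> int) \<Rightarrow> nat \<Rightarrow> (nat \<Rightarrow> nat) \<Rightarrow> log_series \<Rightarrow> log_series" where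
  "partial_monomial s n u = fold (\<lambda>j. partial s j ^^ u j) [1..<Suc n]"

text \<open>\<open>nat\<close> truncates negative integers to zero, which selects the factors of each product.\<close>

definition box :: "(nat \<Rightarrow> int) \<Rightarrow> nat \<Rightarrow> (nat \<Rightarrow> int) \<Rightarrow> log_series \<Rightarrow> log_series" where
  "box s n l F = (\<lambda>w. partial_monomial s n (\<lambda>j. nat (l j)) F w
                    - partial_monomial s n (\<lambda>j. nat (- l j)) F w)"

definition euler ::
    "(nat \<Rightarrow> int) \<Rightarrow> (nat \<Rightarrow> int ^ 'd) \<Rightarrow> nat \<Rightarrow> complex ^ 'd \<Rightarrow> 'd \<Rightarrow> log_series \<Rightarrow> log_series" where
  "euler s a n \<beta> i F =
     (\<lambda>w. (\<Sum>j\<in>{1..n}. smult (of_int (a j $ i)) (mult_var j (partial s j F) w))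
          - smult (\<beta> $ i) (F w))"

definition hypergeometric_solution ::
    "(nat \<Rightarrow> int ^ 'd) \<Rightarrow> nat \<Rightarrow> nat \<Rightarrow> (nat \<Rightarrow> nat) \<Rightarrow> complex ^ 'd \<Rightarrow> log_series \<Rightarrow> bool" where
  "hypergeometric_solution a n k ell \<beta> F \<longleftrightarrow>
     (\<forall>l\<in>rel_lattice n k ell. box (signed n k ell) n l F = (\<lambda>_. 0)) \<and>
     (\<forall>i. euler (signed n k ell) a n \<beta> i F = (\<lambda>_. 0))"

text \<open>
  A polynomial \<open>g\<close> in \<open>log x\<^sub>0\<close> whose coefficients are formal Laurent series in \<open>x\<^sub>0\<close>, multiplied by
  \<open>x\<^sup>v\<close> and expanded by means of \<open>x\<^sup>v x\<^sub>0\<^sup>m = x\<^sup>v\<^sup>+\<^sup>m\<^sup>s\<close>. The integer \<open>m\<close> is determined by the exponent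
  as soon as \<open>s \<noteq> 0\<close>.
\<close>

definition expand :: "(nat \<Rightarrow> int) \<Rightarrow> (nat \<Rightarrow> complex) \<Rightarrow> complex fls poly \<Rightarrow> log_series" where
  "expand s v g = (\<lambda>w.
     if \<exists>m::int. w = (\<lambda>j. v j + of_int (m * s j))
     then map_poly (\<lambda>c. fls_nth c (THE m. w = (\<lambda>j. v j + of_int (m * s j)))) g
     else 0)"

text \<open>The condition \<open>g \<noteq> 0\<close> matters for \<open>\<mu> = 0\<close>, because \<open>degree 0 = 0\<close>.\<close>

definition maximal_unipotent_monodromy ::
    "(nat \<Rightarrow> int ^ 'd) \<Rightarrow> nat \<Rightarrow> nat \<Rightarrow> (nat \<Rightarrow> nat) \<Rightarrow> complex ^ 'd \<Rightarrow> bool" where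
  "maximal_unipotent_monodromy a n k ell \<beta> \<longleftrightarrow>
     (\<exists>v\<in>exponents' a n k ell \<beta>. \<forall>\<mu>::nat. real \<mu> \<le> vol a n - 1 \<longrightarrow>
        (\<exists>g :: complex fls poly. g \<noteq> 0 \<and> degree g = \<mu> \<and>
           hypergeometric_solution a n k ell \<beta> (expand (signed n k ell) v g)))"

end

theory Submission
  imports Defs
begin

text \<open>
  Write \<open>s\<close> for the signed relation and \<open>D\<close> for differentiation with respect to \<open>t = log x\<^sub>0\<close>. A series
  supported on \<open>v + \<int> s\<close> is a sequence of polynomials \<open>c\<^sub>m(t)\<close>, the coefficients of
  \<open>x\<^sup>v x\<^sub>0\<^sup>m\<close>. If \<open>\<Sum>\<^sub>j v\<^sub>j a\<^sub>j = \<beta>\<close>, then such a series satisfies the Euler equations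
  automatically (\<open>euler_expand\<close>). All box equations follow from the one for the generator \<open>s\<close>, because the two
  monomials of the generating box operator commute
  (\<open>box_multiple\<close>). The remaining equation is the two-term recurrence
  \<open>A\<^sub>m(D) c\<^sub>m\<^sub>+\<^sub>1 = B\<^sub>m(D) c\<^sub>m\<close> (\<open>box_expand_eq_0_iff\<close>), in which \<open>A\<^sub>m\<close> and \<open>B\<^sub>m\<close> are products of linear polynomials:
  \<open>A\<^sub>m\<close> has \<open>N\<close> factors, where \<open>N = ell 1 + \<dots> + ell k\<close>, one for each pair \<open>(i, b)\<close> of an index
  \<open>i \<le> k\<close> and \<open>1 \<le> b \<le> ell i\<close>, and \<open>B\<^sub>m\<close> collects the factors that belong to the indices above \<open>k\<close>.

  For \<open>A \<noteq> 0\<close>, the operator \<open>A(D)\<close> is surjective on polynomials, and its kernel consists of the polynomials of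
  degree less than the order of \<open>A\<close> at \<open>0\<close>. So the degree in \<open>t\<close> can grow from \<open>c\<^sub>m\<close> to \<open>c\<^sub>m\<^sub>+\<^sub>1\<close>
  by at most the number of factors of \<open>A\<^sub>m\<close> that vanish at \<open>0\<close>, and each pair \<open>(i, b)\<close> vanishes
  for at most one \<open>m\<close>. As a Laurent series starts with \<open>c\<^sub>m = 0\<close>, the degree never exceeds \<open>N - 1\<close>,
  and it reaches \<open>N - 1\<close> only if all \<open>N\<close> pairs vanish somewhere. The pair \<open>(i, b)\<close> vanishes at \<open>m\<close>
  precisely when \<open>v + (m + 1) s\<close> is the exponent attached to \<open>i\<close> and \<open>ell i - b\<close>, so the condition is
  that all exponents lie in \<open>v + \<int> s\<close>. Conversely, nonresonance makes all \<open>B\<^sub>m(D)\<close>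
  invertible, so that no degree is lost and the recurrence has a solution of degree \<open>N - 1\<close>; its
  derivatives with respect to \<open>t\<close> are solutions of all smaller degrees
  (\<open>solution_of_maximal_degree_imp\<close>, \<open>ex_solution_of_degree\<close>).

  Thus maximal unipotent monodromy means that all exponents lie in one class modulo \<open>\<int> s\<close>.
  Each such class contains exactly one element of \<open>E'\<close>, namely the exponent
  farthest in the direction of \<open>s\<close>: adding a suitable multiple of \<open>s\<close> brings a negative integer
  coordinate \<open>i \<le> k\<close> into the range \<open>0, \<dots>, ell i - 1\<close> and thus gives an exponent farther on, while
  moving back from an exponent makes one of these coordinates a negative integer. So there is one
  class if and only if \<open>E'\<close> is a singleton (\<open>is_singleton_exponents'_iff\<close>).
\<close>

section \<open>Operators with constant coefficients on polynomials in the logarithm\<close>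

text \<open>
  Counting the coefficients up to the leading one, instead of the degree, makes the zero polynomial
  fit into the degree formulas: \<open>A(D)\<close> lowers this number by the order of \<open>A\<close> at \<open>0\<close>, with
  truncated subtraction.
\<close>

definition log_length :: "complex poly \<Rightarrow> nat" where
  "log_length p = (if p = 0 then 0 else Suc (degree p))"

lemma log_length_0 [simp]: "log_length 0 = 0"
  by (simp add: log_length_def)

lemma log_length_eq_0_iff [simp]: "log_length p = 0 \<longleftrightarrow> p = 0"
  by (simp add: log_length_def)

lemma log_length_le_iff: "log_length p \<le> N \<longleftrightarrow> (\<forall>r\<ge>N. coeff p r = 0)"
proof
  assume "log_length p \<le> N"
  then show "\<forall>r\<ge>N. coeff p r = 0"
    by (auto simp: log_length_def coeff_eq_0 split: if_splits)
next
  assume *: "\<forall>r\<ge>N. coeff p r = 0"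
  show "log_length p \<le> N"
  proof (cases "p = 0")
    case False
    then have "\<not> N \<le> degree p" using * leading_coeff_0_iff by blast
    with False show ?thesis by (simp add: log_length_def)
  qed simp
qed

lemma log_length_add_le: "log_length (p + q) \<le> max (log_length p) (log_length q)"
  unfolding log_length_le_iff
  by (auto simp: log_length_def coeff_eq_0)

lemma log_length_smult [simp]: "c \<noteq> 0 \<Longrightarrow> log_length (smult c p) = log_length p"
  by (simp add: log_length_def)

lemma log_length_smult_le: "log_length (smult c p) \<le> log_length p"
  by (simp add: log_length_def)

lemma log_length_add_eq:
  assumes "log_length q < log_length p"
  shows "log_length (p + q) = log_length p"
proof (rule antisym)
  show "log_length (p + q) \<le> log_length p"
    using log_length_add_le[of p q] assms by simp
  have "log_length (- q) = log_length q"
    by (simp add: log_length_def)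
  then show "log_length p \<le> log_length (p + q)"
    using assms log_length_add_le[of "p + q" "- q"] by simp
qed

lemma log_length_pderiv: "log_length (pderiv p) = log_length p - 1"
  by (auto simp: log_length_def degree_pderiv pderiv_eq_0_iff)

lemma log_length_pderiv_funpow: "log_length ((pderiv ^^ t) p) = log_length p - t"
  by (induction t) (simp_all add: log_length_pderiv)

lemma ex_antiderivative:
  fixes q :: "complex poly"
  shows "\<exists>p. pderiv p = q \<and> log_length p = Suc (log_length q)"
proof (cases "q = 0")
  case True
  then show ?thesis by (intro exI[of _ 1]) (simp add: log_length_def)
next
  case False
  define p where "p = (\<Sum>i\<le>degree q. monom (coeff q i / of_nat (Suc i)) (Suc i))"
  have "pderiv p = (\<Sum>i\<le>degree q. monom (coeff q i) i)"
    unfolding p_def higher_pderiv_sum[of 1, simplified]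
    by (simp add: pderiv_monom del: of_nat_Suc)
  then have p: "pderiv p = q" by (simp add: poly_as_sum_of_monoms)
  with False have "p \<noteq> 0" by auto
  then have "log_length p \<noteq> 0" by simp
  with p log_length_pderiv[of p] have "log_length p = Suc (log_length q)"
    by (metis Suc_diff_1 neq0_conv)
  with p show ?thesis by blast
qed

text \<open>
  This is \<open>A(D)\<close>, where \<open>D = pderiv\<close>, evaluated by the Horner scheme.
\<close>

definition deriv_op :: "complex poly \<Rightarrow> complex poly \<Rightarrow> complex poly" where
  "deriv_op A = fold_coeffs (\<lambda>a f p. smult a p + pderiv (f p)) A (\<lambda>_. 0)"

lemma deriv_op_0 [simp]: "deriv_op 0 p = 0"
  by (simp add: deriv_op_def)

lemma deriv_op_pCons: "deriv_op (pCons a A) p = smult a p + pderiv (deriv_op A p)"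
  unfolding deriv_op_def
  by (cases "A = 0 \<and> a = 0") (auto simp: fold_coeffs_pCons_coeff_not_0_eq fold_coeffs_pCons_not_0_0_eq)

lemma deriv_op_add_right: "deriv_op A (p + q) = deriv_op A p + deriv_op A q"
  by (induction A) (simp_all add: deriv_op_pCons smult_add_right pderiv_add)

lemma deriv_op_smult_right: "deriv_op A (smult c p) = smult c (deriv_op A p)"
  by (induction A) (simp_all add: deriv_op_pCons smult_add_right pderiv_smult mult.commute)

lemma deriv_op_0_right [simp]: "deriv_op A 0 = 0"
  using deriv_op_smult_right[of A 0 0] by simp

lemma deriv_op_pderiv: "deriv_op A (pderiv p) = pderiv (deriv_op A p)"
  by (induction A) (simp_all add: deriv_op_pCons pderiv_add pderiv_smult)

lemma deriv_op_1 [simp]: "deriv_op 1 p = p"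
  by (simp add: one_pCons deriv_op_pCons)

lemma deriv_op_add: "deriv_op (A + B) p = deriv_op A p + deriv_op B p"
proof (induction A arbitrary: B)
  case (pCons a A)
  then show ?case
    by (cases B) (simp add: deriv_op_pCons smult_add_left pderiv_add)
qed simp

lemma deriv_op_smult: "deriv_op (smult c A) p = smult c (deriv_op A p)"
  by (induction A) (simp_all add: deriv_op_pCons smult_add_right pderiv_smult)

lemma deriv_op_mult: "deriv_op (A * B) p = deriv_op A (deriv_op B p)"
  by (induction A) (simp_all add: deriv_op_pCons deriv_op_add deriv_op_smult)

lemma deriv_op_X_power: "deriv_op ([:0, 1:] ^ r) p = (pderiv ^^ r) p"
  by (induction r) (simp_all add: deriv_op_mult deriv_op_pCons)

lemma log_length_deriv_op_le: "log_length (deriv_op A p) \<le> log_length p"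
proof (induction A)
  case (pCons a A)
  have "log_length (pderiv (deriv_op A p)) \<le> log_length p"
    using pCons.IH by (simp add: log_length_pderiv)
  then show ?case
    using log_length_add_le[of "smult a p" "pderiv (deriv_op A p)"] log_length_smult_le[of a p]
    by (simp add: deriv_op_pCons)
qed simp

text \<open>
  With a nonzero constant term \<open>a\<close>, the operator is \<open>a\<close> plus a multiple of \<open>D\<close>, which affects
  lower terms only.
\<close>

lemma log_length_deriv_op_unit:
  assumes "coeff A 0 \<noteq> 0"
  shows "log_length (deriv_op A p) = log_length p"
proof (cases A)
  case (pCons a A')
  with assms have "a \<noteq> 0" by simp
  show ?thesis
  proof (cases "p = 0")
    case False
    then have "log_length p \<noteq> 0" by simp
    then have "log_length (pderiv (deriv_op A' p)) < log_length p"
      using log_length_deriv_op_le[of A' p] by (simp only: log_length_pderiv)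
    with \<open>a \<noteq> 0\<close> log_length_add_eq[of "pderiv (deriv_op A' p)" "smult a p"]
    show ?thesis by (simp add: pCons deriv_op_pCons)
  qed simp
qed

text \<open>
  One step of Newton iteration: \<open>q / a\<close> solves the equation up to an error of smaller degree.
\<close>

lemma deriv_op_unit_surj:
  assumes "coeff A 0 \<noteq> 0"
  shows "\<exists>p. deriv_op A p = q"
proof (induction "log_length q" arbitrary: q rule: less_induct)
  case less
  obtain a A' where A: "A = pCons a A'" by (cases A)
  with assms have a: "a \<noteq> 0" by simp
  show ?case
  proof (cases "q = 0")
    case True
    then show ?thesis by (intro exI[of _ 0]) simp
  next
    case False
    then have "log_length q \<noteq> 0" by simp
    define q' where "q' = smult (- inverse a) (pderiv (deriv_op A' q))"
    have "log_length q' < log_length q"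
    proof -
      have "log_length q' \<le> log_length q - 1"
        using log_length_smult_le[of "- inverse a" "pderiv (deriv_op A' q)"]
          log_length_deriv_op_le[of A' q] unfolding q'_def log_length_pderiv by linarith
      then show ?thesis using \<open>log_length q \<noteq> 0\<close> by linarith
    qed
    from less[OF this] obtain p' where "deriv_op A p' = q'" by blast
    then have "deriv_op A (p' + smult (inverse a) q) = q"
      using a by (simp add: deriv_op_add_right deriv_op_smult_right q'_def)
        (simp add: A deriv_op_pCons smult_add_right)
    then show ?thesis by blast
  qed
qed

lemma order_0_factor:
  assumes "(A :: complex poly) \<noteq> 0"
  obtains B where "A = [:0, 1:] ^ order 0 A * B" "coeff B 0 \<noteq> 0"
proof -
  obtain B where B: "A = [:- 0, 1:] ^ order 0 A * B" "\<not> [:- 0, 1:] dvd B"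
    using order_decomp[OF assms, of 0] by blast
  then have "poly B 0 \<noteq> 0" using poly_eq_0_iff_dvd[of B 0] by simp
  with B that[of B] show ?thesis by (simp add: poly_0_coeff_0)
qed

text \<open>
  Up to an invertible operator, \<open>A(D)\<close> is the power of \<open>D\<close> given by the order of \<open>A\<close> at \<open>0\<close>.
\<close>

lemma log_length_deriv_op:
  assumes "A \<noteq> 0"
  shows "log_length (deriv_op A p) = log_length p - order 0 A"
proof -
  obtain B where B: "A = [:0, 1:] ^ order 0 A * B" "coeff B 0 \<noteq> 0"
    using order_0_factor[OF assms] .
  have "deriv_op A p = (pderiv ^^ order 0 A) (deriv_op B p)"
    by (subst B(1)) (simp only: deriv_op_mult deriv_op_X_power)
  then show ?thesis
    using B(2) by (simp add: log_length_pderiv_funpow log_length_deriv_op_unit)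
qed

text \<open>
  For \<open>q = 0\<close> this yields an element of the kernel of the largest possible degree, so that the
  statement also serves to start a recursion at zero.
\<close>

lemma deriv_op_surj:
  assumes "A \<noteq> 0"
  shows "\<exists>p. deriv_op A p = q \<and> log_length p = log_length q + order 0 A"
proof -
  have int: "\<exists>p. (pderiv ^^ r) p = q \<and> log_length p = log_length q + r" for r
  proof (induction r)
    case (Suc r)
    then obtain p where p: "(pderiv ^^ r) p = q" "log_length p = log_length q + r" by blast
    obtain p' where "pderiv p' = p" "log_length p' = Suc (log_length p)"
      using ex_antiderivative by blast
    with p show ?case by (intro exI[of _ p']) (simp add: funpow_swap1)
  qed simp
  obtain B where B: "A = [:0, 1:] ^ order 0 A * B" "coeff B 0 \<noteq> 0"
    using order_0_factor[OF assms] .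
  from int obtain p where p: "(pderiv ^^ order 0 A) p = q" "log_length p = log_length q + order 0 A"
    by blast
  obtain p' where p': "deriv_op B p' = p" using deriv_op_unit_surj[OF B(2)] by blast
  have "deriv_op A p' = q"
    by (subst B(1)) (simp only: deriv_op_mult deriv_op_X_power p p')
  moreover have "log_length p' = log_length p"
    using log_length_deriv_op_unit[OF B(2), of p'] p' by simp
  ultimately show ?thesis using p(2) by auto
qed

section \<open>Two-term recurrences\<close>

definition log_recurrence :: "(int \<Rightarrow> complex poly) \<Rightarrow> (int \<Rightarrow> complex poly) \<Rightarrow> (int \<Rightarrow> complex poly) \<Rightarrow> bool"
  where "log_recurrence A B c \<longleftrightarrow> (\<forall>m. deriv_op (A m) (c (m + 1)) = deriv_op (B m) (c m))"

lemma sum_int_upto_Suc: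
  "m0 \<le> m \<Longrightarrow> (\<Sum>i\<in>{m0..<m + 1}. f i) = (\<Sum>i\<in>{m0..<m}. f i) + f m" for m0 m :: int
proof -
  assume "m0 \<le> m"
  then have "{m0..<m + 1} = insert m {m0..<m}" by auto
  then show ?thesis by (simp add: add.commute)
qed

text \<open>
  Passing from \<open>c m\<close> to \<open>c (m + 1)\<close>, the right-hand side does not increase the length, and undoing
  \<open>A m\<close> increases it by at most the order.
\<close>

lemma log_recurrence_length_le:
  assumes rec: "log_recurrence A B c" and "\<And>m. A m \<noteq> 0" and low: "\<And>m. m \<le> m0 \<Longrightarrow> c m = 0"
  shows "log_length (c m) \<le> (\<Sum>i\<in>{m0..<m}. order 0 (A i))"
proof (cases "m0 \<le> m")
  case True
  then show ?thesis
  proof (induction m rule: int_ge_induct)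
    case base
    then show ?case by (simp add: low)
  next
    case (step m)
    have "log_length (c (m + 1)) - order 0 (A m) \<le> log_length (c m)"
      using rec assms(2) log_length_deriv_op log_length_deriv_op_le
      by (metis log_recurrence_def)
    with step show ?case by (simp add: sum_int_upto_Suc)
  qed
qed (simp add: low)

text \<open>
  The bound of the preceding lemma is attained: start with zero and solve for the next coefficient
  with as large a degree as possible. Invertibility of the operators \<open>B m\<close> ensures that the degree
  gained is never lost again.
\<close>

lemma ex_log_recurrence_solution:
  assumes "\<And>m. A m \<noteq> 0" and "\<And>m. coeff (B m) 0 \<noteq> 0"
  shows "\<exists>c. log_recurrence A B c \<and> (\<forall>m\<le>m0. c m = 0) \<and>
             (\<forall>m. log_length (c m) = (\<Sum>i\<in>{m0..<m}. order 0 (A i)))"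
proof -
  define next_coeff where "next_coeff m q =
    (SOME p. deriv_op (A m) p = deriv_op (B m) q \<and> log_length p = log_length q + order 0 (A m))" for m q
  have nc: "deriv_op (A m) (next_coeff m q) = deriv_op (B m) q \<and>
      log_length (next_coeff m q) = log_length q + order 0 (A m)" for m q
  proof -
    have "\<exists>p. deriv_op (A m) p = deriv_op (B m) q \<and> log_length p = log_length q + order 0 (A m)"
      using deriv_op_surj[OF assms(1), of m "deriv_op (B m) q"]
      by (simp add: log_length_deriv_op_unit[OF assms(2)])
    then show ?thesis unfolding next_coeff_def by (rule someI_ex)
  qed
  define c where "c m = rec_nat 0 (\<lambda>t. next_coeff (m0 + int t)) (nat (m - m0))" for m
  have low: "c m = 0" if "m \<le> m0" for m
    using that by (simp add: c_def)
  have stp: "c (m + 1) = next_coeff m (c m)" if "m0 \<le> m" for m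
  proof -
    have "nat (m + 1 - m0) = Suc (nat (m - m0))" using that by simp
    then show ?thesis using that by (simp add: c_def)
  qed
  have "log_recurrence A B c"
    unfolding log_recurrence_def
  proof
    fix m
    show "deriv_op (A m) (c (m + 1)) = deriv_op (B m) (c m)"
      by (cases "m0 \<le> m") (simp_all add: stp nc low)
  qed
  moreover have "log_length (c m) = (\<Sum>i\<in>{m0..<m}. order 0 (A i))" for m
  proof (cases "m0 \<le> m")
    case True
    then show ?thesis
    proof (induction m rule: int_ge_induct)
      case base
      then show ?case by (simp add: low)
    next
      case (step m)
      then show ?case by (simp add: stp nc sum_int_upto_Suc)
    qed
  qed (simp add: low)
  ultimately show ?thesis using low by blast
qed

lemma log_recurrence_pderiv_funpow:
  assumes "log_recurrence A B c"
  shows "log_recurrence A B (\<lambda>m. (pderiv ^^ t) (c m))"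
proof (induction t)
  case (Suc t)
  then show ?case by (simp add: log_recurrence_def deriv_op_pderiv)
qed (simp add: assms)

section \<open>The box operators\<close>

text \<open>
  Applying \<open>\<partial>\<^sub>j\<close> repeatedly to \<open>x\<^sup>w p(log x\<^sub>0)\<close> acts on \<open>p\<close> by successive linear
  polynomials in \<open>D\<close>. The product is indexed by the exponent \<open>w\<close> of the result, so its factors
  are \<open>w\<^sub>j + b + s\<^sub>j D\<close> with \<open>b\<close> counted from \<open>1\<close>.
\<close>

definition symbol :: "(nat \<Rightarrow> int) \<Rightarrow> nat \<Rightarrow> (nat \<Rightarrow> nat) \<Rightarrow> (nat \<Rightarrow> complex) \<Rightarrow> complex poly" where
  "symbol s n u w = (\<Prod>j\<in>{1..n}. \<Prod>b\<in>{1..u j}. [:w j + of_nat b, of_int (s j):])"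

lemma partial_funpow:
  "(partial s j ^^ u) F w =
     deriv_op (\<Prod>b\<in>{1..u}. [:w j + of_nat b, of_int (s j):]) (F (w(j := w j + of_nat u)))"
proof (induction u arbitrary: w)
  case (Suc u)
  have "(\<Prod>b\<in>{1..Suc u}. [:w j + of_nat b, of_int (s j):]) =
        [:w j + 1, of_int (s j):] * (\<Prod>b\<in>{1..u}. [:w j + 1 + of_nat b, of_int (s j):])"
    by (subst prod.atLeast_Suc_atMost, simp, subst prod.shift_bounds_cl_Suc_ivl)
      (simp add: add.assoc)
  moreover have "(partial s j ^^ Suc u) F w =
      deriv_op [:w j + 1, of_int (s j):] ((partial s j ^^ u) F (w(j := w j + 1)))"
    by (simp add: partial_def deriv_op_pCons Let_def pderiv_smult)
  moreover have "(w(j := w j + 1))(j := (w(j := w j + 1)) j + of_nat u) = w(j := w j + of_nat (Suc u))"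
    by (simp add: fun_eq_iff)
  ultimately show ?case
    by (simp only: Suc.IH deriv_op_mult fun_upd_same)
qed simp

lemma partial_monomial_eq:
  "partial_monomial s n u F w =
     deriv_op (symbol s n u w) (F (\<lambda>j. w j + (if j \<in> {1..n} then of_nat (u j) else 0)))"
proof (induction n arbitrary: w)
  case 0
  then show ?case by (simp add: partial_monomial_def symbol_def)
next
  case (Suc n)
  let ?w' = "w(Suc n := w (Suc n) + of_nat (u (Suc n)))"
  have "symbol s n u ?w' = symbol s n u w"
    unfolding symbol_def by (intro prod.cong refl) auto
  moreover have "(\<lambda>j. ?w' j + (if j \<in> {1..n} then of_nat (u j) else 0)) =
      (\<lambda>j. w j + (if j \<in> {1..Suc n} then of_nat (u j) else 0))"
    by (auto simp: fun_eq_iff)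
  moreover have "partial_monomial s (Suc n) u F w =
      (partial s (Suc n) ^^ u (Suc n)) (partial_monomial s n u F) w"
    by (simp add: partial_monomial_def)
  ultimately have "partial_monomial s (Suc n) u F w =
      deriv_op (\<Prod>b\<in>{1..u (Suc n)}. [:w (Suc n) + of_nat b, of_int (s (Suc n)):])
       (deriv_op (symbol s n u w) (F (\<lambda>j. w j + (if j \<in> {1..Suc n} then of_nat (u j) else 0))))"
    by (simp only: partial_funpow Suc.IH)
  then show ?case
    by (simp add: symbol_def deriv_op_mult[symmetric] mult.commute)
qed

text \<open>
  The factors for \<open>u'\<close>, read at the exponent shifted by \<open>u\<close>, continue the
  rising products for \<open>u\<close>. As addition of \<open>u\<close> and \<open>u'\<close> is symmetric, monomials in the partial
  derivatives commute.
\<close>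

lemma partial_monomial_add:
  "partial_monomial s n (\<lambda>j. u j + u' j) F = partial_monomial s n u (partial_monomial s n u' F)"
proof
  fix w :: "nat \<Rightarrow> complex"
  let ?w' = "\<lambda>j. w j + (if j \<in> {1..n} then of_nat (u j) else 0)"
  have "(\<Prod>b\<in>{1..u j + u' j}. [:w j + of_nat b, of_int (s j):]) =
        (\<Prod>b\<in>{1..u j}. [:w j + of_nat b, of_int (s j):]) *
        (\<Prod>b\<in>{1..u' j}. [:?w' j + of_nat b, of_int (s j):])" if "j \<in> {1..n}" for j
  proof -
    have "?w' j + of_nat b = w j + of_nat (b + u j)" for b
      using that by (simp add: add_ac)
    then have "(\<Prod>b\<in>{1..u' j}. [:?w' j + of_nat b, of_int (s j):]) =
        (\<Prod>b\<in>{1 + u j..u' j + u j}. [:w j + of_nat b, of_int (s j):])"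
      by (simp only: prod.shift_bounds_cl_nat_ivl)
    then show ?thesis
      using prod.ub_add_nat[of 1 "u j" "\<lambda>b. [:w j + of_nat b, of_int (s j):]" "u' j"]
      by (simp only: add.commute[of _ "u j"] le_add2)
  qed
  then have "symbol s n (\<lambda>j. u j + u' j) w = symbol s n u w * symbol s n u' ?w'"
    unfolding symbol_def prod.distrib[symmetric] by (intro prod.cong) auto
  moreover have "(\<lambda>j. w j + (if j \<in> {1..n} then of_nat (u j + u' j) else 0)) =
      (\<lambda>j. ?w' j + (if j \<in> {1..n} then of_nat (u' j) else 0))"
    by auto
  ultimately show "partial_monomial s n (\<lambda>j. u j + u' j) F w =
      partial_monomial s n u (partial_monomial s n u' F) w"
    by (simp only: partial_monomial_eq deriv_op_mult)
qed

lemma partial_monomial_zero: "partial_monomial s n (\<lambda>_. 0) F = F"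
  by (rule ext) (simp add: partial_monomial_eq symbol_def cong: if_cong)

text \<open>
  For commuting operators \<open>P\<close> and \<open>Q\<close>, the equation \<open>P F = Q F\<close> implies
  \<open>P\<^sup>t F = Q\<^sup>t F\<close> by induction on \<open>t\<close>.
\<close>

lemma partial_monomial_multiple_cong:
  assumes "partial_monomial s n u F = partial_monomial s n u' F"
  shows "partial_monomial s n (\<lambda>j. t * u j) F = partial_monomial s n (\<lambda>j. t * u' j) F"
proof (induction t)
  case 0
  then show ?case by (simp add: partial_monomial_zero)
next
  case (Suc t)
  have "partial_monomial s n (\<lambda>j. Suc t * u j) F =
      partial_monomial s n (\<lambda>j. t * u j) (partial_monomial s n u' F)"
    using assms partial_monomial_add[of s n "\<lambda>j. t * u j" u] by (simp add: add.commute)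
  also have "\<dots> = partial_monomial s n u' (partial_monomial s n (\<lambda>j. t * u j) F)"
    by (simp only: partial_monomial_add[symmetric] add.commute)
  also have "\<dots> = partial_monomial s n (\<lambda>j. Suc t * u' j) F"
    by (simp add: Suc.IH partial_monomial_add)
  finally show ?case .
qed

text \<open>
  The positive and the negative part of \<open>m s\<close> are multiples of those of \<open>s\<close>, interchanged if
  \<open>m < 0\<close>.
\<close>

lemma box_multiple:
  assumes "box s n s F = (\<lambda>_. 0)"
  shows "box s n (\<lambda>j. m * s j) F = (\<lambda>_. 0)"
proof -
  let ?pos = "\<lambda>j. nat (s j)" and ?neg = "\<lambda>j. nat (- s j)"
  have eq: "partial_monomial s n ?pos F = partial_monomial s n ?neg F"
    using assms by (auto simp: box_def fun_eq_iff)
  show ?thesis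
  proof (cases "m \<ge> 0")
    case True
    then have "(\<lambda>j. nat (m * s j)) = (\<lambda>j. nat m * nat (s j))"
      and "(\<lambda>j. nat (- (m * s j))) = (\<lambda>j. nat m * nat (- s j))"
      using nat_mult_distrib[of m] by (auto simp flip: mult_minus_right)
    then show ?thesis
      using partial_monomial_multiple_cong[OF eq, of "nat m"] by (simp add: box_def)
  next
    case False
    then have "(\<lambda>j. nat (m * s j)) = (\<lambda>j. nat (- m) * nat (- s j))"
      and "(\<lambda>j. nat (- (m * s j))) = (\<lambda>j. nat (- m) * nat (s j))"
      using nat_mult_distrib[of "- m"] by (auto simp flip: mult_minus_left) (metis minus_mult_minus)
    then show ?thesis
      using partial_monomial_multiple_cong[OF eq, of "nat (- m)"] by (simp add: box_def)
  qed
qed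

section \<open>Series supported on a translate of the relation lattice\<close>

definition translate :: "(nat \<Rightarrow> int) \<Rightarrow> (nat \<Rightarrow> complex) \<Rightarrow> int \<Rightarrow> nat \<Rightarrow> complex" where
  "translate s v m = (\<lambda>j. v j + of_int (m * s j))"

lemma translate_inject: "s j \<noteq> 0 \<Longrightarrow> translate s v m = translate s v m' \<longleftrightarrow> m = m'"
  by (auto simp: translate_def dest: fun_cong[of _ _ j])

definition layer :: "complex fls poly \<Rightarrow> int \<Rightarrow> complex poly" where
  "layer g m = map_poly (\<lambda>c. fls_nth c m) g"

lemma coeff_layer: "coeff (layer g m) r = fls_nth (coeff g r) m"
  by (simp add: layer_def coeff_map_poly)

lemma expand_translate:
  assumes "s j \<noteq> 0"
  shows "expand s v g (translate s v m) = layer g m"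
proof -
  have "(THE m'. translate s v m = (\<lambda>j. v j + of_int (m' * s j))) = m"
    using translate_inject[of s j v] assms unfolding translate_def[symmetric]
    by (intro the_equality) auto
  then show ?thesis
    by (auto simp: expand_def layer_def translate_def)
qed

lemma expand_outside: "w \<notin> range (translate s v) \<Longrightarrow> expand s v g w = 0"
  by (auto simp: expand_def translate_def)

text \<open>
  The Euler operators act on \<open>x\<^sup>w p(log x\<^sub>0)\<close> through \<open>\<Sum>\<^sub>j a\<^sub>j (w\<^sub>j + s\<^sub>j D)\<close>. The coefficient of \<open>D\<close>
  vanishes since \<open>s\<close> is a relation, and \<open>\<Sum>\<^sub>j w\<^sub>j a\<^sub>j\<close> is constant along \<open>v + \<int> s\<close>.
\<close>

lemma euler_expand:
  assumes "s j0 \<noteq> 0"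
    and v: "(\<Sum>j\<in>{1..n}. v j *s of_int_vec (a j)) = \<beta>"
    and s: "(\<Sum>j\<in>{1..n}. s j *s a j) = 0"
  shows "euler s a n \<beta> i (expand s v g) = (\<lambda>_. 0)"
proof
  fix w
  let ?F = "expand s v g"
  have step: "mult_var j (partial s j ?F) w = smult (w j) (?F w) + smult (of_int (s j)) (pderiv (?F w))" for j
    by (simp add: mult_var_def partial_def Let_def)
  show "euler s a n \<beta> i ?F w = 0"
  proof (cases "w \<in> range (translate s v)")
    case False
    then show ?thesis by (simp add: euler_def step expand_outside)
  next
    case True
    then obtain m where w: "w = translate s v m" by blast
    have vi: "(\<Sum>j\<in>{1..n}. v j * of_int (a j $ i)) = \<beta> $ i"
      using arg_cong[OF v, of "\<lambda>x. x $ i"] by (simp add: of_int_vec_def)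
    have "(\<Sum>j\<in>{1..n}. s j * (a j $ i)) = 0"
      using arg_cong[OF s, of "\<lambda>x. x $ i"] by simp
    then have si: "(\<Sum>j\<in>{1..n}. of_int (s j) * of_int (a j $ i)) = (0 :: complex)"
      by (simp flip: of_int_mult of_int_sum)
    have wi: "(\<Sum>j\<in>{1..n}. w j * of_int (a j $ i)) = \<beta> $ i"
      using vi si unfolding w translate_def
      by (simp add: distrib_right sum.distrib mult.assoc sum_distrib_left[symmetric])
    have "(\<Sum>j\<in>{1..n}. smult (of_int (a j $ i)) (mult_var j (partial s j ?F) w)) =
        smult (\<Sum>j\<in>{1..n}. w j * of_int (a j $ i)) (?F w) +
        smult (\<Sum>j\<in>{1..n}. of_int (s j) * of_int (a j $ i)) (pderiv (?F w))"
      by (simp add: step smult_add_right sum.distrib smult_sum mult.commute)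
    then show ?thesis by (simp only: euler_def wi si) simp
  qed
qed

text \<open>
  Subtracting the negative part of \<open>s\<close> from \<open>v + m s\<close> gives the same exponent as subtracting the
  positive part from \<open>v + (m + 1) s\<close>. At this exponent the two monomials of the box operator bring
  together the coefficients with the numbers \<open>m\<close> and \<open>m + 1\<close>.
\<close>

definition base_point :: "(nat \<Rightarrow> int) \<Rightarrow> (nat \<Rightarrow> complex) \<Rightarrow> int \<Rightarrow> nat \<Rightarrow> complex" where
  "base_point s v m = (\<lambda>j. translate s v m j - of_nat (nat (- s j)))"

definition up_symbol :: "(nat \<Rightarrow> int) \<Rightarrow> nat \<Rightarrow> (nat \<Rightarrow> complex) \<Rightarrow> int \<Rightarrow> complex poly" where
  "up_symbol s n v m = symbol s n (\<lambda>j. nat (s j)) (base_point s v m)"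

definition down_symbol :: "(nat \<Rightarrow> int) \<Rightarrow> nat \<Rightarrow> (nat \<Rightarrow> complex) \<Rightarrow> int \<Rightarrow> complex poly" where
  "down_symbol s n v m = symbol s n (\<lambda>j. nat (- s j)) (base_point s v m)"

lemma box_expand_eq_0_iff:
  assumes s0: "s j0 \<noteq> 0" and supp: "\<And>j. j \<notin> {1..n} \<Longrightarrow> s j = 0"
  shows "box s n s (expand s v g) = (\<lambda>_. 0) \<longleftrightarrow>
         log_recurrence (up_symbol s n v) (down_symbol s n v) (layer g)"
proof -
  let ?F = "expand s v g"
  have box: "box s n s ?F w =
      deriv_op (symbol s n (\<lambda>j. nat (s j)) w) (?F (\<lambda>j. w j + of_nat (nat (s j)))) -
      deriv_op (symbol s n (\<lambda>j. nat (- s j)) w) (?F (\<lambda>j. w j + of_nat (nat (- s j))))" for w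
  proof -
    have "(\<lambda>j. w j + (if j \<in> {1..n} then of_nat (nat (s j)) else 0)) = (\<lambda>j. w j + of_nat (nat (s j)))"
      and "(\<lambda>j. w j + (if j \<in> {1..n} then of_nat (nat (- s j)) else 0)) = (\<lambda>j. w j + of_nat (nat (- s j)))"
      using supp by fastforce+
    then show ?thesis by (simp only: box_def partial_monomial_eq)
  qed
  have of_int_nat_split: "of_nat (nat (s x)) - of_nat (nat (- s x)) = (of_int (s x) :: complex)" for x
    by (cases "s x \<ge> 0") (auto simp: of_nat_nat)
  have up: "(\<lambda>j. base_point s v m j + of_nat (nat (s j))) = translate s v (m + 1)"
    and down: "(\<lambda>j. base_point s v m j + of_nat (nat (- s j))) = translate s v m" for m
    using of_int_nat_split by (auto simp: base_point_def translate_def fun_eq_iff ring_distribs)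
  have at_base: "box s n s ?F (base_point s v m) =
      deriv_op (up_symbol s n v m) (layer g (m + 1)) - deriv_op (down_symbol s n v m) (layer g m)" for m
    by (simp add: box up down up_symbol_def down_symbol_def expand_translate[of s j0, OF s0])
  have elsewhere: "box s n s ?F w = 0" if "w \<notin> range (base_point s v)" for w
  proof -
    have "(\<lambda>j. w j + of_nat (nat (- s j))) \<notin> range (translate s v)"
    proof
      assume "(\<lambda>j. w j + of_nat (nat (- s j))) \<in> range (translate s v)"
      then obtain m where "(\<lambda>j. w j + of_nat (nat (- s j))) = translate s v m" by blast
      then have "w = base_point s v m" by (auto simp: base_point_def fun_eq_iff algebra_simps)
      with that show False by blast
    qed
    moreover have "(\<lambda>j. w j + of_nat (nat (s j))) \<notin> range (translate s v)"
    proof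
      assume "(\<lambda>j. w j + of_nat (nat (s j))) \<in> range (translate s v)"
      then obtain m where "(\<lambda>j. w j + of_nat (nat (s j))) = translate s v (m - 1 + 1)" by auto
      then have "w = base_point s v (m - 1)"
        unfolding up[symmetric] by (auto simp: fun_eq_iff)
      with that show False by blast
    qed
    ultimately show ?thesis by (simp add: box expand_outside)
  qed
  show ?thesis
  proof
    assume "box s n s ?F = (\<lambda>_. 0)"
    then show "log_recurrence (up_symbol s n v) (down_symbol s n v) (layer g)"
      using at_base by (simp add: log_recurrence_def)
  next
    assume rec: "log_recurrence (up_symbol s n v) (down_symbol s n v) (layer g)"
    show "box s n s ?F = (\<lambda>_. 0)"
    proof
      fix w
      show "box s n s ?F w = 0"
        using rec at_base elsewhere[of w] by (cases "w \<in> range (base_point s v)") (auto simp: log_recurrence_def)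
    qed
  qed
qed

lemma order_0_linear: "s \<noteq> 0 \<Longrightarrow> order 0 [:c, s:] = (if c = 0 then 1 else 0)" for s :: complex
proof (cases "c = 0")
  case True
  assume "s \<noteq> 0"
  have "order 0 [:0, s:] = order 0 (smult s [:0, 1:])" by simp
  also have "\<dots> = order 0 [:- 0, 1 :: complex:]" using \<open>s \<noteq> 0\<close> by (subst order_smult) auto
  also have "\<dots> = 1" using order_power_n_n[of "0::complex" 1] by simp
  finally show ?thesis using True by simp
next
  case False
  assume "s \<noteq> 0"
  show ?thesis using False by (simp add: order_root poly_0_coeff_0 order_0I)
qed

lemma order_prod:
  "finite A \<Longrightarrow> (\<And>x. x \<in> A \<Longrightarrow> f x \<noteq> 0) \<Longrightarrow> order z (\<Prod>x\<in>A. f x) = (\<Sum>x\<in>A. order z (f x))"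
  for f :: "'a \<Rightarrow> complex poly"
  by (induction rule: finite_induct) (simp_all add: order_mult)

text \<open>
  For \<open>s j > 0\<close> the base point agrees with \<open>translate s v m\<close> in the coordinate \<open>j\<close>, so these are
  the factors of \<open>up_symbol s n v m\<close> without constant term.
\<close>

definition vanishing_factors :: "(nat \<Rightarrow> int) \<Rightarrow> nat \<Rightarrow> (nat \<Rightarrow> complex) \<Rightarrow> int \<Rightarrow> (nat \<times> nat) set" where
  "vanishing_factors s n v m =
     {(j, b). j \<in> {1..n} \<and> b \<in> {1..nat (s j)} \<and> translate s v m j + of_nat b = 0}"

lemma
  shows up_symbol_nonzero: "up_symbol s n v m \<noteq> 0"
    and order_up_symbol: "order 0 (up_symbol s n v m) = card (vanishing_factors s n v m)"
proof -
  have nz: "[:base_point s v m j + of_nat b, of_int (s j) :: complex:] \<noteq> 0" if "b \<in> {1..nat (s j)}" for j b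
    using that by (cases "s j = 0") auto
  show "up_symbol s n v m \<noteq> 0"
    using nz by (auto simp: up_symbol_def symbol_def prod_zero_iff)
  have "order 0 (up_symbol s n v m) =
      (\<Sum>j\<in>{1..n}. order 0 (\<Prod>b\<in>{1..nat (s j)}. [:base_point s v m j + of_nat b, of_int (s j):]))"
    unfolding up_symbol_def symbol_def by (rule order_prod) (use nz in \<open>auto simp: prod_zero_iff\<close>)
  also have "\<dots> = (\<Sum>j\<in>{1..n}. \<Sum>b\<in>{1..nat (s j)}.
      order 0 [:base_point s v m j + of_nat b, of_int (s j):])"
    by (intro sum.cong refl order_prod) (use nz in auto)
  also have "\<dots> = (\<Sum>j\<in>{1..n}. \<Sum>b\<in>{1..nat (s j)}. if translate s v m j + of_nat b = 0 then 1 else 0)"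
    by (intro sum.cong refl, subst order_0_linear) (auto simp: base_point_def)
  also have "\<dots> = (\<Sum>(j, b)\<in>Sigma {1..n} (\<lambda>j. {1..nat (s j)}). if translate s v m j + of_nat b = 0 then 1 else 0)"
    by (subst sum.Sigma) auto
  also have "\<dots> = card (vanishing_factors s n v m)"
    by (subst card_eq_sum, rule sum.mono_neutral_cong_right) (auto simp: vanishing_factors_def split: if_splits)
  finally show "order 0 (up_symbol s n v m) = card (vanishing_factors s n v m)" .
qed

text \<open>
  The constant terms of the factors differ from coordinates of \<open>v\<close> by integers.
\<close>

lemma down_symbol_unit:
  assumes "\<And>j. j \<in> {1..n} \<Longrightarrow> s j < 0 \<Longrightarrow> v j \<notin> \<int>"
  shows "coeff (down_symbol s n v m) 0 \<noteq> 0"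
proof -
  have "base_point s v m j + of_nat b \<noteq> 0" if j: "j \<in> {1..n}" and b: "b \<in> {1..nat (- s j)}" for j b
  proof
    assume "base_point s v m j + of_nat b = 0"
    then have "v j = of_int (int (nat (- s j)) - int b - m * s j)"
      by (simp add: base_point_def translate_def algebra_simps)
    then have "v j \<in> \<int>" by (metis Ints_of_int)
    moreover have "s j < 0" using b by (cases "s j < 0") auto
    ultimately show False using assms[OF j] by blast
  qed
  then show ?thesis
    by (auto simp: down_symbol_def symbol_def poly_0_coeff_0[symmetric] poly_prod prod_zero_iff)
qed

text \<open>
  Translation by \<open>s\<close> strictly moves the coordinates with \<open>s j > 0\<close>, so a given factor vanishes for
  at most one \<open>m\<close>.
\<close>

lemma sum_card_vanishing_factors:
  assumes "finite M"
  shows "(\<Sum>m\<in>M. card (vanishing_factors s n v m)) = card (\<Union>m\<in>M. vanishing_factors s n v m)"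
proof (rule card_UN_disjoint[symmetric])
  show "\<forall>m\<in>M. finite (vanishing_factors s n v m)"
  proof
    fix m
    have "vanishing_factors s n v m \<subseteq> Sigma {1..n} (\<lambda>j. {1..nat (s j)})"
      by (auto simp: vanishing_factors_def)
    then show "finite (vanishing_factors s n v m)" by (rule finite_subset) simp
  qed
  show "\<forall>m\<in>M. \<forall>m'\<in>M. m \<noteq> m' \<longrightarrow> vanishing_factors s n v m \<inter> vanishing_factors s n v m' = {}"
  proof (intro ballI impI equals0I)
    fix m m' x assume "m \<noteq> m'" and x: "x \<in> vanishing_factors s n v m \<inter> vanishing_factors s n v m'"
    obtain j b where jb: "x = (j, b)" by fastforce
    with x have "translate s v m j = translate s v m' j" "s j \<noteq> 0"
      by (auto simp: vanishing_factors_def) (metis add_right_cancel)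
    with \<open>m \<noteq> m'\<close> show False by (simp add: translate_def)
  qed
qed fact

text \<open>
  A sequence of polynomials comes from a polynomial with Laurent series coefficients as soon as it
  vanishes far to the left and its degrees are bounded.
\<close>

lemma ex_layers:
  assumes low: "\<And>m. m \<le> m0 \<Longrightarrow> c m = 0" and len: "\<And>m. log_length (c m) \<le> N"
  shows "\<exists>g. layer g = c"
proof -
  have nth: "fls_nth (Abs_fls (\<lambda>m. coeff (c m) r)) m = coeff (c m) r" for r m
    by (rule nth_Abs_fls_lower_bound[of "m0"]) (simp add: low)
  define g where "g = (\<Sum>r<N. monom (Abs_fls (\<lambda>m. coeff (c m) r)) r)"
  have "coeff g r = (if r < N then Abs_fls (\<lambda>m. coeff (c m) r) else 0)" for r
    by (simp add: g_def coeff_sum)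
  then have "coeff (layer g m) r = coeff (c m) r" for m r
    using len[of m] by (auto simp: coeff_layer nth log_length_le_iff)
  then have "layer g = c" by (auto simp: poly_eq_iff)
  then show ?thesis ..
qed

lemma degree_layers:
  assumes "g \<noteq> 0"
  shows "\<exists>m. log_length (layer g m) = Suc (degree g)" and "log_length (layer g m) \<le> Suc (degree g)"
proof -
  show le: "log_length (layer g m) \<le> Suc (degree g)" for m
    by (auto simp: log_length_le_iff coeff_layer coeff_eq_0)
  from assms obtain m where "fls_nth (lead_coeff g) m \<noteq> 0"
    by (metis fls_nonzeroI leading_coeff_0_iff fls_eq_iff fls_zero_nth)
  then have "\<not> log_length (layer g m) \<le> degree g"
    by (auto simp: log_length_le_iff coeff_layer)
  with le[of m] have "log_length (layer g m) = Suc (degree g)" by simp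
  then show "\<exists>m. log_length (layer g m) = Suc (degree g)" ..
qed

lemma layers_bounded_below: "\<exists>m0. \<forall>m\<le>m0. layer g m = 0"
proof -
  define m0 where "m0 = Min ((\<lambda>r. fls_subdegree (coeff g r)) ` {..degree g}) - 1"
  have "layer g m = 0" if "m \<le> m0" for m
  proof (rule poly_eqI)
    fix r
    show "coeff (layer g m) r = coeff 0 r"
    proof (cases "r \<le> degree g")
      case True
      then have "Min ((\<lambda>r. fls_subdegree (coeff g r)) ` {..degree g}) \<le> fls_subdegree (coeff g r)"
        by (intro Min_le) auto
      then have "m0 < fls_subdegree (coeff g r)" by (simp add: m0_def)
      with that show ?thesis by (simp add: coeff_layer)
    qed (simp add: coeff_layer coeff_eq_0)
  qed
  then show ?thesis by blast
qed

section \<open>Linear algebra of a configuration with one relation\<close>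

lemma group_closure_scaleR:
  fixes x :: "'v :: real_vector"
  assumes "x \<in> group_closure S"
  shows "of_int m *\<^sub>R x \<in> group_closure S"
proof (induction m rule: int_induct[of _ 0])
  case (step1 i)
  then show ?case using group_closure_add[OF _ assms] by (simp add: scaleR_add_left)
next
  case (step2 i)
  then show ?case using group_closure.diff[OF _ assms] by (simp add: scaleR_diff_left)
qed simp

lemma independent_image_coeff_zero:
  fixes f :: "'i \<Rightarrow> 'v :: real_vector"
  assumes "independent (f ` I)" "inj_on f I" "finite I" "(\<Sum>i\<in>I. c i *\<^sub>R f i) = 0" "i \<in> I"
  shows "c i = 0"
proof -
  define u where "u = c \<circ> inv_into I f"
  have u: "u (f j) = c j" if "j \<in> I" for j
    using that assms(2) by (simp add: u_def)
  then have "(\<Sum>x\<in>f ` I. u x *\<^sub>R x) = 0"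
    using assms(2,4) by (simp add: sum.reindex)
  then have "\<forall>x\<in>f ` I. u x = 0"
    using assms(1,3) dependent_finite[of "f ` I"] by blast
  then show ?thesis
    using assms(5) u by simp
qed

definition lies_over :: "(nat \<Rightarrow> int ^ 'd) \<Rightarrow> nat \<Rightarrow> complex ^ 'd \<Rightarrow> (nat \<Rightarrow> complex) \<Rightarrow> bool" where
  "lies_over a n \<beta> v \<longleftrightarrow>
     (\<forall>j. j \<notin> {1..n} \<longrightarrow> v j = 0) \<and> (\<Sum>j\<in>{1..n}. v j *s of_int_vec (a j)) = \<beta>"

lemma ex_lies_over:
  assumes "\<beta> \<in> complex_span a n"
  shows "\<exists>v. lies_over a n \<beta> v"
  using assms unfolding complex_span_def
proof (induction rule: vec.span_induct_alt)
  case base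
  show ?case by (intro exI[of _ "\<lambda>_. 0"]) (simp add: lies_over_def)
next
  case (step c x y)
  then obtain v i where v: "lies_over a n y v" and i: "i \<in> {1..n}" "x = of_int_vec (a i)" by auto
  have "(\<Sum>j\<in>{1..n}. (v j + (if j = i then c else 0)) *s of_int_vec (a j)) =
      y + (\<Sum>j\<in>{1..n}. if j = i then c *s of_int_vec (a j) else 0)"
    using v unfolding lies_over_def
    by (simp add: vec.scale_left_distrib sum.distrib if_distrib[of "\<lambda>c. c *s _"] cong: if_cong)
  also have "\<dots> = c *s x + y" using i by simp
  finally have "lies_over a n (c *s x + y) (\<lambda>j. v j + (if j = i then c else 0))"
    using v i by (auto simp: lies_over_def)
  then show ?case by blast
qed

locale one_relation =
  fixes a :: "nat \<Rightarrow> int ^ 'd" and n k :: nat and ell :: "nat \<Rightarrow> nat"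
  assumes dim_span: "dim (real_span a n) = n - 1"
    and indep: "\<And>S. S \<subseteq> pts a n \<Longrightarrow> card S = n - 1 \<Longrightarrow> independent S"
    and k: "1 \<le> k" "k \<le> n"
    and ell_pos: "\<And>j. j \<in> {1..n} \<Longrightarrow> ell j > 0"
    and rel: "relations a n = rel_lattice n k ell"
begin

abbreviation s :: "nat \<Rightarrow> int" where "s \<equiv> signed n k ell"

lemma s_pos: "i \<in> {1..k} \<Longrightarrow> s i = int (ell i)"
  and s_neg: "j \<in> {k+1..n} \<Longrightarrow> s j = - int (ell j)"
  using k by (auto simp: signed_def)

lemma s_outside: "j \<notin> {1..n} \<Longrightarrow> s j = 0"
  using k by (auto simp: signed_def)

lemma s_nonzero: "j \<in> {1..n} \<Longrightarrow> s j \<noteq> 0"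
  using ell_pos[of j] k by (auto simp: signed_def)

lemma s_1: "s 1 \<noteq> 0"
  using s_nonzero[of 1] k by simp

lemma sum_s: "(\<Sum>j\<in>{1..n}. s j *s a j) = 0"
proof -
  have "s \<in> rel_lattice n k ell" unfolding rel_lattice_def by (rule range_eqI[of _ _ 1]) simp
  then show ?thesis using rel by (auto simp: relations_def)
qed

lemma sum_s_field:
  "(\<Sum>j\<in>{1..n}. of_int (s j) *s of_int_vec (a j)) = (0 :: 'f::field ^ 'd)"
proof -
  have "(\<Sum>j\<in>{1..n}. of_int (s j) * of_int (a j $ i)) = (0 :: 'f)" for i
  proof -
    have "(\<Sum>j\<in>{1..n}. s j * (a j $ i)) = 0"
      using arg_cong[OF sum_s, of "\<lambda>x. x $ i"] by simp
    from arg_cong[OF this, of "of_int :: int \<Rightarrow> 'f"] show ?thesis by simp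
  qed
  then show ?thesis by (simp add: vec_eq_iff of_int_vec_def)
qed

text \<open>
  Equal vectors \<open>a p = a q\<close> would give an integer relation that vanishes at \<open>j\<close>. All
  nonzero relations are nonzero everywhere.
\<close>

lemma inj_on_pts_delete:
  assumes "j \<in> {1..n}"
  shows "inj_on (\<lambda>p. of_int_vec (a p) :: real ^ 'd) ({1..n} - {j})"
proof (rule inj_onI, rule ccontr)
  fix p q
  assume p: "p \<in> {1..n} - {j}" and q: "q \<in> {1..n} - {j}" and "p \<noteq> q"
    and "of_int_vec (a p) = (of_int_vec (a q) :: real ^ 'd)"
  then have eq: "a p = a q" by (simp add: of_int_vec_def vec_eq_iff)
  define r :: "nat \<Rightarrow> int" where "r = (\<lambda>i. (if i = p then 1 else 0) - (if i = q then 1 else 0))"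
  have "(\<Sum>i\<in>{1..n}. r i *s a i) =
      (\<Sum>i\<in>{1..n}. if i = p then a i else 0) - (\<Sum>i\<in>{1..n}. if i = q then a i else 0)"
    unfolding sum_subtractf[symmetric] by (intro sum.cong) (auto simp: r_def vec_eq_iff)
  also have "\<dots> = 0" using p q eq by simp
  finally have "r \<in> rel_lattice n k ell"
    using p q by (auto simp: rel[symmetric] relations_def r_def)
  then obtain m where m: "r i = m * s i" for i by (auto simp: rel_lattice_def)
  have "m = 0" using m[of j] p q s_nonzero[OF assms] by (auto simp: r_def split: if_splits)
  with m[of p] \<open>p \<noteq> q\<close> show False by (simp add: r_def)
qed

lemma independent_pts_delete:
  assumes "j \<in> {1..n}"
  shows "independent ((\<lambda>p. of_int_vec (a p) :: real ^ 'd) ` ({1..n} - {j}))"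
proof (rule indep)
  show "card ((\<lambda>p. of_int_vec (a p) :: real ^ 'd) ` ({1..n} - {j})) = n - 1"
    by (simp only: card_image[OF inj_on_pts_delete[OF assms]]) (use assms in simp)
qed (auto simp: pts_def)

text \<open>
  Subtracting a real multiple of \<open>s\<close> makes the coefficient at \<open>k\<close> vanish; the other vectors are
  linearly independent.
\<close>

lemma real_relation:
  assumes "(\<Sum>j\<in>{1..n}. c j *\<^sub>R of_int_vec (a j)) = (0 :: real ^ 'd)" "j \<in> {1..n}"
  shows "c j = c k / of_int (s k) * of_int (s j)"
proof -
  have kn: "k \<in> {1..n}" using k by simp
  define t where "t = c k / of_int (s k)"
  define d where "d j = c j - t * of_int (s j)" for j
  have dk: "d k = 0" using s_nonzero[OF kn] by (simp add: d_def t_def)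
  have "(\<Sum>j\<in>{1..n}. of_int (s j) *\<^sub>R of_int_vec (a j)) = (0 :: real ^ 'd)"
    using sum_s_field[where 'f = real] by (simp add: scalar_mult_eq_scaleR)
  then have "(\<Sum>j\<in>{1..n}. (t * of_int (s j)) *\<^sub>R of_int_vec (a j)) = (0 :: real ^ 'd)"
    by (simp flip: scaleR_scaleR scaleR_sum_right)
  then have "(\<Sum>j\<in>{1..n}. d j *\<^sub>R of_int_vec (a j)) = (0 :: real ^ 'd)"
    using assms(1) by (simp add: d_def scaleR_diff_left sum_subtractf)
  then have "(\<Sum>j\<in>{1..n} - {k}. d j *\<^sub>R of_int_vec (a j)) = (0 :: real ^ 'd)"
    using dk sum.remove[OF finite_atLeastAtMost kn, of "\<lambda>j. d j *\<^sub>R (of_int_vec (a j) :: real ^ 'd)"]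
    by simp
  then have "d j = 0" if "j \<in> {1..n} - {k}"
    using independent_image_coeff_zero[OF independent_pts_delete[OF kn] inj_on_pts_delete[OF kn]] that
    by blast
  with dk assms(2) have "d j = 0" by (cases "j = k") auto
  then show ?thesis by (simp add: d_def t_def)
qed

lemma complex_relation:
  assumes "(\<Sum>j\<in>{1..n}. c j *s of_int_vec (a j)) = (0 :: complex ^ 'd)"
  shows "\<exists>t. \<forall>j\<in>{1..n}. c j = t * of_int (s j)"
proof -
  have sum0: "(\<Sum>j\<in>{1..n}. c j * of_int (a j $ i)) = 0" for i
    using arg_cong[OF assms, of "\<lambda>x. x $ i"] by (simp add: of_int_vec_def)
  have "(\<Sum>j\<in>{1..n}. Re (c j) *\<^sub>R of_int_vec (a j)) = (0 :: real ^ 'd)"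
    using arg_cong[OF sum0, of Re] by (simp add: vec_eq_iff of_int_vec_def)
  note Re = real_relation[OF this]
  have "(\<Sum>j\<in>{1..n}. Im (c j) *\<^sub>R of_int_vec (a j)) = (0 :: real ^ 'd)"
    using arg_cong[OF sum0, of Im] by (simp add: vec_eq_iff of_int_vec_def)
  note Im = real_relation[OF this]
  show ?thesis
  proof (intro exI ballI)
    fix j assume "j \<in> {1..n}"
    then show "c j = Complex (Re (c k) / of_int (s k)) (Im (c k) / of_int (s k)) * of_int (s j)"
      by (simp only: complex_eq_iff times_complex.sel complex.sel Re Im complex_Re_of_int complex_Im_of_int) simp
  qed
qed

lemma lies_over_shift:
  assumes "lies_over a n \<beta> v"
  shows "lies_over a n \<beta> (\<lambda>j. v j + t * of_int (s j))"
proof -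
  have "(\<Sum>j\<in>{1..n}. (t * of_int (s j)) *s of_int_vec (a j)) = (0 :: complex ^ 'd)"
    by (simp only: vec.scale_scale[symmetric] vec.scale_sum_right[symmetric]
        sum_s_field vec.scale_zero_right)
  then show ?thesis
    using assms by (auto simp: lies_over_def vec.scale_left_distrib sum.distrib s_outside)
qed

lemma lies_over_translate: "lies_over a n \<beta> v \<Longrightarrow> lies_over a n \<beta> (translate s v m)"
  using lies_over_shift[of \<beta> v "of_int m"] by (simp add: translate_def)

text \<open>
  Two representations of \<open>\<beta>\<close> differ by a complex multiple of \<open>s\<close>, which has no zero coordinate.
\<close>

lemma lies_over_eqI:
  assumes v: "lies_over a n \<beta> v" and w: "lies_over a n \<beta> w" and i: "i \<in> {1..n}" "v i = w i"
  shows "v = w"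
proof -
  have "(\<Sum>j\<in>{1..n}. (v j - w j) *s of_int_vec (a j)) = 0"
    using v w by (simp add: lies_over_def vec.scale_left_diff_distrib sum_subtractf)
  then obtain t where t: "\<And>j. j \<in> {1..n} \<Longrightarrow> v j - w j = t * of_int (s j)"
    using complex_relation[of "\<lambda>j. v j - w j"] by blast
  from t[OF i(1)] i s_nonzero have "t = 0" by simp
  show ?thesis
  proof
    fix j
    show "v j = w j"
      using t[of j] \<open>t = 0\<close> v w by (cases "j \<in> {1..n}") (auto simp: lies_over_def)
  qed
qed

end

section \<open>Exponents\<close>

locale one_relation_parameter = one_relation a n k ell
  for a :: "nat \<Rightarrow> int ^ 'd" and n k ell +
  fixes \<beta> :: "complex ^ 'd"
  assumes parameter: "\<beta> \<in> complex_span a n"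
begin

abbreviation "E \<equiv> exponents a n k ell \<beta>"
abbreviation "E' \<equiv> exponents' a n k ell \<beta>"

lemma exponent:
  assumes i: "i \<in> {1..n}"
  shows lies_over_exponent: "lies_over a n \<beta> (exponent a n \<beta> i b)"
    and exponent_at: "exponent a n \<beta> i b i = of_nat b"
    and exponent_eqI: "lies_over a n \<beta> v \<Longrightarrow> v i = of_nat b \<Longrightarrow> exponent a n \<beta> i b = v"
proof -
  obtain v0 where v0: "lies_over a n \<beta> v0" using ex_lies_over[OF parameter] by blast
  let ?v = "\<lambda>j. v0 j + (of_nat b - v0 i) / of_int (s i) * of_int (s j)"
  have v: "lies_over a n \<beta> ?v" "?v i = of_nat b"
    by (rule lies_over_shift[OF v0]) (use s_nonzero[OF i] in simp)
  have uniq: "exponent a n \<beta> i b = w" if "lies_over a n \<beta> w" "w i = of_nat b" for w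
    unfolding exponent_def
  proof (rule the_equality)
    show "(\<forall>j. j \<notin> {1..n} \<longrightarrow> w j = 0) \<and> w i = of_nat b \<and>
        (\<Sum>j\<in>{1..n}. w j *s of_int_vec (a j)) = \<beta>"
      using that by (simp add: lies_over_def)
  next
    fix u assume "(\<forall>j. j \<notin> {1..n} \<longrightarrow> u j = 0) \<and> u i = of_nat b \<and>
        (\<Sum>j\<in>{1..n}. u j *s of_int_vec (a j)) = \<beta>"
    then show "u = w" using that i by (intro lies_over_eqI[of \<beta> u w i]) (auto simp: lies_over_def)
  qed
  show "lies_over a n \<beta> (exponent a n \<beta> i b)" "exponent a n \<beta> i b i = of_nat b"
    using uniq[OF v] v by simp_all
  show "lies_over a n \<beta> v \<Longrightarrow> v i = of_nat b \<Longrightarrow> exponent a n \<beta> i b = v"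
    by (rule uniq)
qed

lemma exponents_iff:
  "v \<in> E \<longleftrightarrow> lies_over a n \<beta> v \<and> (\<exists>i\<in>{1..k}. \<exists>b<ell i. v i = of_nat b)"
proof
  assume "v \<in> E"
  then obtain i b where "i \<in> {1..k}" "b < ell i" "v = exponent a n \<beta> i b"
    by (auto simp: exponents_def)
  with k show "lies_over a n \<beta> v \<and> (\<exists>i\<in>{1..k}. \<exists>b<ell i. v i = of_nat b)"
    using lies_over_exponent[of i b] exponent_at[of i b] by auto
next
  assume "lies_over a n \<beta> v \<and> (\<exists>i\<in>{1..k}. \<exists>b<ell i. v i = of_nat b)"
  with k exponent_eqI show "v \<in> E" unfolding exponents_def by fastforce
qed

lemma finite_exponents: "finite E"
proof -
  have "E = (\<lambda>(i, b). exponent a n \<beta> i b) ` Sigma {1..k} (\<lambda>i. {..<ell i})"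
    unfolding exponents_def by force
  then show ?thesis by simp
qed

text \<open>
  If \<open>v + m s\<close> is an exponent and \<open>m > 0\<close>, then going back to \<open>v\<close> turns its coordinate
  \<open>b < ell i\<close> into a negative integer, so that \<open>v\<close> is not in \<open>E'\<close>. The case \<open>m < 0\<close> is the same
  with the two exponents interchanged.
\<close>

lemma exponents'_translate_unique:
  assumes v: "v \<in> E'" and w: "translate s v m \<in> E'"
  shows "m = 0"
proof -
  have le: "m \<le> 0" if v: "v \<in> E'" and w: "translate s v m \<in> E" for v m
  proof (rule ccontr)
    assume "\<not> m \<le> 0"
    from w obtain i b where i: "i \<in> {1..k}" and b: "b < ell i" "translate s v m i = of_nat b"
      by (auto simp: exponents_iff)
    then have "v i = of_int (int b - m * int (ell i))"
      by (simp add: translate_def s_pos algebra_simps)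
    moreover have "int b - m * int (ell i) < 0"
      using b(1) \<open>\<not> m \<le> 0\<close> mult_right_mono[of 1 m "int (ell i)"] by linarith
    moreover have "v i \<notin> {of_int z | z :: int. z < 0}"
      using v i by (simp add: exponents'_def)
    ultimately show False by blast
  qed
  have "translate s (translate s v m) (- m) = v" by (simp add: translate_def)
  with le[OF v, of m] le[OF w, of "- m"] v w show ?thesis by (simp add: exponents'_def)
qed

text \<open>
  The exponent farthest in the direction of \<open>s\<close> within its class belongs to \<open>E'\<close>: a negative
  integer coordinate could be moved to its residue modulo \<open>ell i\<close>, giving an exponent that is
  farther still.
\<close>

lemma ex_translate_exponents':
  assumes u: "u \<in> E"
  shows "\<exists>m. translate s u m \<in> E'"
proof -
  define M where "M = {m. translate s u m \<in> E}"
  have "inj (translate s u)" using s_1 by (auto intro!: injI simp: translate_inject)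
  then have "finite M"
    unfolding M_def using finite_vimageI[OF finite_exponents] by (auto simp: vimage_def)
  moreover have "0 \<in> M" using u by (simp add: M_def translate_def)
  ultimately have Max: "Max M \<in> M" "\<And>m. m \<in> M \<Longrightarrow> m \<le> Max M" by (auto intro: Max_in)
  let ?v = "translate s u (Max M)"
  have v: "?v \<in> E" using Max(1) by (simp add: M_def)
  have "?v i \<noteq> of_int z" if i: "i \<in> {1..k}" and z: "z < 0" for i z
  proof
    assume vi: "?v i = of_int z"
    define t where "t = - (z div int (ell i))"
    have ell: "ell i > 0" using i k ell_pos by simp
    then have "t > 0" using z by (simp add: t_def div_neg_pos_less0)
    have "translate s u (Max M + t) i = ?v i + of_int (t * int (ell i))"
      using i by (simp add: translate_def s_pos algebra_simps)
    also have "\<dots> = of_int (z mod int (ell i))"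
      unfolding vi t_def of_int_add[symmetric] by (simp add: minus_div_mult_eq_mod[symmetric])
    also have "\<dots> = of_nat (nat (z mod int (ell i)))"
      using ell by simp
    finally have "translate s u (Max M + t) i = of_nat (nat (z mod int (ell i)))" .
    moreover have "nat (z mod int (ell i)) < ell i"
      using ell by (simp add: nat_less_iff)
    moreover have "lies_over a n \<beta> (translate s u (Max M + t))"
      using u by (simp add: exponents_iff lies_over_translate)
    ultimately have "translate s u (Max M + t) \<in> E" using i unfolding exponents_iff by blast
    then have "Max M + t \<in> M" by (simp add: M_def)
    from Max(2)[OF this] \<open>t > 0\<close> show False by simp
  qed
  with v have "?v \<in> E'" by (auto simp: exponents'_def)
  then show ?thesis ..
qed

text \<open>
  The primitive functional that vanishes on all vectors except \<open>a i\<close> and \<open>a j\<close> takes on these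
  the coprime values \<open>ell j / g\<close> and \<open>ell i / g\<close>, where \<open>g\<close> is the greatest common divisor; this is
  forced by the relation up to sign. If both coordinates of \<open>v\<close> were integers, then its value at
  \<open>\<beta>\<close> would be an integer.
\<close>

lemma nonresonant_not_int:
  assumes nonres: "nonresonant a n k \<beta>" and v: "lies_over a n \<beta> v"
    and i: "i \<in> {1..k}" "v i \<in> \<int>" and j: "j \<in> {k+1..n}"
  shows "v j \<notin> \<int>"
proof
  assume vj: "v j \<in> \<int>"
  have ij: "i \<in> {1..n}" "j \<in> {1..n}" "i \<noteq> j" using i j k by auto
  let ?A = "\<lambda>p. of_int_vec (a p) :: real ^ 'd"
  let ?B = "?A ` ({1..n} - {j})"
  define g where "g = gcd (int (ell i)) (int (ell j))"
  define p where "p = int (ell j) div g"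
  define q where "q = int (ell i) div g"
  have ell: "ell i > 0" "ell j > 0" using ell_pos ij by auto
  have cross: "int (ell j) * q = int (ell i) * p"
    unfolding p_def q_def g_def by (metis div_mult_swap gcd_dvd1 gcd_dvd2 mult.commute)
  have coprime: "coprime q p"
    unfolding p_def q_def g_def using ell by (intro div_gcd_coprime) auto
  \<comment> \<open>Prescribe \<open>h\<close> on the basis that omits \<open>a j\<close>; the relation then determines \<open>h (a j)\<close>.\<close>
  obtain h :: "real ^ 'd \<Rightarrow> real" where h: "linear h" "\<And>x. x \<in> ?B \<Longrightarrow> h x = (if x = ?A i then of_int p else 0)"
    using linear_independent_extend[OF independent_pts_delete[OF ij(2)], of "\<lambda>x. if x = ?A i then of_int p else 0"]
    by (auto simp: real_scaleR_def)
  have hi: "h (?A i) = of_int p" using h(2) ij by auto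
  have other: "h (?A r) = 0" if "r \<in> {1..n} - {i, j}" for r
  proof -
    have "?A r \<noteq> ?A i" using inj_on_pts_delete[OF ij(2)] that ij by (auto dest: inj_onD)
    then show ?thesis using h(2)[of "?A r"] that by auto
  qed
  have hsum: "h (\<Sum>r\<in>{1..n}. c r *\<^sub>R ?A r) = c i * h (?A i) + c j * h (?A j)" for c
  proof -
    have "h (\<Sum>r\<in>{1..n}. c r *\<^sub>R ?A r) = (\<Sum>r\<in>{1..n}. c r * h (?A r))"
      by (simp add: linear_sum[OF h(1)] linear_cmul[OF h(1)])
    also have "\<dots> = (\<Sum>r\<in>{i, j}. c r * h (?A r))"
      using ij other by (intro sum.mono_neutral_right) auto
    finally show ?thesis using ij by simp
  qed
  have "h (\<Sum>r\<in>{1..n}. of_int (s r) *\<^sub>R ?A r) = 0"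
    using sum_s_field[where 'f = real] linear_0[OF h(1)] by (simp add: scalar_mult_eq_scaleR)
  then have "real (ell i) * of_int p = real (ell j) * h (?A j)"
    using hsum[of "\<lambda>r. of_int (s r)"] i j by (simp add: hi s_pos s_neg)
  moreover have "real (ell i) * of_int p = real (ell j) * of_int q"
    using arg_cong[OF cross, of real_of_int] by simp
  ultimately have hj: "h (?A j) = of_int q" using ell by simp

  have int_on_pts: "h x \<in> \<int>" if "x \<in> pts a n" for x
    using that hi hj other by (auto simp: pts_def) (metis Diff_iff Ints_0 Ints_of_int atLeastAtMost_iff empty_iff insert_iff)
  have "h ` lattice a n = \<int>"
  proof (intro equalityI subsetI)
    fix y assume "y \<in> h ` lattice a n"
    then obtain x where x: "x \<in> group_closure (pts a n)" "y = h x" by (auto simp: lattice_def)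
    from x(1) have "h x \<in> \<int>"
      by induction (auto simp: linear_0[OF h(1)] linear_diff[OF h(1)] int_on_pts)
    with x(2) show "y \<in> \<int>" by simp
  next
    fix y :: real assume "y \<in> \<int>"
    then obtain z where z: "y = of_int z" by (auto elim: Ints_cases)
    obtain x' y' where bez: "x' * q + y' * p = 1"
      using bezout_int[of q p] coprime by (auto simp: coprime_iff_gcd_eq_1)
    let ?x = "of_int (z * y') *\<^sub>R ?A i + of_int (z * x') *\<^sub>R ?A j"
    have "?x \<in> lattice a n"
      using ij unfolding lattice_def
      by (intro group_closure_add group_closure_scaleR group_closure.base) (auto simp: pts_def)
    moreover have "h ?x = of_int (z * (x' * q + y' * p))"
      by (simp add: linear_add[OF h(1)] linear_cmul[OF h(1)] hi hj algebra_simps)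
    ultimately show "y \<in> h ` lattice a n" using z bez by (metis image_eqI mult.right_neutral)
  qed
  moreover
  let ?H = "span (?B - {?A i})"
  have "h x = 0" if "x \<in> ?H" for x
    by (intro linear_eq_0_on_span[OF h(1) _ that]) (use h(2) in auto)
  ultimately have prim: "primitive_functional a n ?H h"
    using h(1) by (simp add: primitive_functional_def)

  have indB: "independent ?B" by (rule independent_pts_delete[OF ij(2)])
  have iB: "?A i \<in> ?B" using ij by blast
  have "dim ?H = card (?B - {?A i})"
    by (rule dim_span_eq_card_independent, rule independent_mono[OF indB]) blast
  moreover have "card ?B = Suc (card (?B - {?A i}))"
    by (rule card.remove[OF _ iB]) simp
  ultimately have "dim ?H + 1 = card ?B" by simp
  also have "card ?B = dim (real_span a n)"
    using ij(2) by (simp only: card_image[OF inj_on_pts_delete[OF ij(2)]] dim_span) simp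
  finally have "dim ?H + 1 = dim (real_span a n)" .
  moreover have "?H \<subseteq> real_span a n"
    unfolding real_span_def pts_def by (intro span_mono) blast
  moreover have "pts a n - {?A i, ?A j} \<subseteq> ?H"
  proof -
    have "pts a n - {?A i, ?A j} \<subseteq> ?B - {?A i}" unfolding pts_def by blast
    then show ?thesis using span_superset by blast
  qed
  ultimately have "hyperplane_omitting a n i j ?H"
    by (simp add: hyperplane_omitting_def subspace_span)
  with nonres prim i(1) j have notint: "complexify h \<beta> \<notin> \<int>"
    unfolding nonresonant_def by blast

  have coord: "\<beta> $ x = (\<Sum>r\<in>{1..n}. v r * of_int (a r $ x))" for x
    using v by (auto simp: lies_over_def of_int_vec_def)
  have "(\<chi> x. Re (\<beta> $ x)) = (\<Sum>r\<in>{1..n}. Re (v r) *\<^sub>R ?A r)"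
    and "(\<chi> x. Im (\<beta> $ x)) = (\<Sum>r\<in>{1..n}. Im (v r) *\<^sub>R ?A r)"
    by (simp_all add: vec_eq_iff coord of_int_vec_def)
  then have "complexify h \<beta> = v i * of_int p + v j * of_int q"
    by (simp only: complexify_def hsum hi hj) (simp add: complex_eq_iff)
  also have "\<dots> \<in> \<int>" using i(2) vj by simp
  finally show False using notint by contradiction
qed

end

section \<open>Vanishing factors, exponents and solutions\<close>

context one_relation_parameter
begin

abbreviation "factor_positions \<equiv> Sigma {1..k} (\<lambda>i. {1..ell i})"

lemma vanishing_factors_iff:
  "(j, b) \<in> vanishing_factors s n v m \<longleftrightarrow>
     (j, b) \<in> factor_positions \<and> translate s v m j + of_nat b = 0"
proof (cases "j \<in> {1..k}")
  case True
  with k show ?thesis by (simp add: vanishing_factors_def s_pos)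
next
  case False
  then have "s j \<le> 0" by (auto simp: signed_def)
  then have "nat (s j) = 0" by simp
  with False show ?thesis by (auto simp: vanishing_factors_def)
qed

text \<open>
  The factor \<open>(i, b)\<close> vanishes at \<open>m\<close> if and only if \<open>v + (m + 1) s\<close> has the coordinate
  \<open>ell i - b\<close> at \<open>i\<close>, which means that it is the exponent attached to \<open>i\<close> and \<open>ell i - b\<close>.
\<close>

lemma all_factors_vanish_iff:
  assumes v: "lies_over a n \<beta> v"
  shows "(\<Union>m. vanishing_factors s n v m) = factor_positions \<longleftrightarrow> E \<subseteq> range (translate s v)"
proof
  assume all: "(\<Union>m. vanishing_factors s n v m) = factor_positions"
  show "E \<subseteq> range (translate s v)"
  proof
    fix u assume "u \<in> E"
    then obtain i b where u: "lies_over a n \<beta> u" and i: "i \<in> {1..k}" and b: "b < ell i" "u i = of_nat b"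
      by (auto simp: exponents_iff)
    have "(i, ell i - b) \<in> factor_positions" using i b by auto
    with all obtain m where "(i, ell i - b) \<in> vanishing_factors s n v m" by blast
    then have "translate s v m i + of_nat (ell i - b) = 0"
      by (simp add: vanishing_factors_iff)
    then have "translate s v (m + 1) i = u i"
      using i b by (simp add: translate_def s_pos of_nat_diff algebra_simps)
    then have "translate s v (m + 1) = u"
      using lies_over_eqI[OF lies_over_translate[OF v] u, of i] i k by simp
    then show "u \<in> range (translate s v)" by blast
  qed
next
  assume E: "E \<subseteq> range (translate s v)"
  have "(i, b) \<in> (\<Union>m. vanishing_factors s n v m)" if ib: "(i, b) \<in> factor_positions" for i b
  proof -
    have i: "i \<in> {1..n}" "i \<in> {1..k}" and b: "ell i - b < ell i" "b \<le> ell i" using ib k by auto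
    have "exponent a n \<beta> i (ell i - b) \<in> E" using i b unfolding exponents_def by blast
    with E obtain m where "exponent a n \<beta> i (ell i - b) = translate s v m" by blast
    then have "translate s v m i = of_nat (ell i - b)" using exponent_at[OF i(1)] by metis
    then have "translate s v (m - 1) i + of_nat b = 0"
      using i b by (simp add: translate_def s_pos of_nat_diff algebra_simps)
    with ib have "(i, b) \<in> vanishing_factors s n v (m - 1)" by (simp add: vanishing_factors_iff)
    then show ?thesis by blast
  qed
  moreover have "vanishing_factors s n v m \<subseteq> factor_positions" for m
    using vanishing_factors_iff by auto
  ultimately show "(\<Union>m. vanishing_factors s n v m) = factor_positions" by fast
qed

lemma hypergeometric_solution_expand_iff:
  assumes v: "lies_over a n \<beta> v"
  shows "hypergeometric_solution a n k ell \<beta> (expand s v g) \<longleftrightarrow>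
         log_recurrence (up_symbol s n v) (down_symbol s n v) (layer g)"
proof -
  have "euler s a n \<beta> i (expand s v g) = (\<lambda>_. 0)" for i
    using v sum_s s_1 by (intro euler_expand[of s 1]) (auto simp: lies_over_def)
  moreover have "(\<forall>l\<in>rel_lattice n k ell. box s n l (expand s v g) = (\<lambda>_. 0)) \<longleftrightarrow>
      box s n s (expand s v g) = (\<lambda>_. 0)"
  proof
    assume "\<forall>l\<in>rel_lattice n k ell. box s n l (expand s v g) = (\<lambda>_. 0)"
    moreover have "s \<in> rel_lattice n k ell" unfolding rel_lattice_def by (rule range_eqI[of _ _ 1]) simp
    ultimately show "box s n s (expand s v g) = (\<lambda>_. 0)" by blast
  next
    assume "box s n s (expand s v g) = (\<lambda>_. 0)"
    from box_multiple[OF this] show "\<forall>l\<in>rel_lattice n k ell. box s n l (expand s v g) = (\<lambda>_. 0)"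
      by (auto simp: rel_lattice_def)
  qed
  ultimately show ?thesis
    unfolding hypergeometric_solution_def
    using box_expand_eq_0_iff[of s 1 n v g] s_1 s_outside by simp
qed

abbreviation "N \<equiv> \<Sum>i\<in>{1..k}. ell i"

lemma card_factor_positions: "card factor_positions = N"
  by (simp add: card_SigmaI)

lemma sum_order_up_symbol:
  "(\<Sum>i\<in>{m0..<m}. order 0 (up_symbol s n v i)) = card (\<Union>i\<in>{m0..<m}. vanishing_factors s n v i)"
  by (simp add: order_up_symbol sum_card_vanishing_factors)

lemma UN_vanishing_factors_subset: "(\<Union>i\<in>I. vanishing_factors s n v i) \<subseteq> factor_positions"
  using vanishing_factors_iff by fast

text \<open>
  The largest length of a coefficient is at most the number of factors that have vanished up to
  there. If it equals \<open>N\<close>, then all factors have vanished.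
\<close>

lemma solution_of_maximal_degree_imp:
  assumes v: "lies_over a n \<beta> v" and g: "g \<noteq> 0" "Suc (degree g) = N"
    and sol: "hypergeometric_solution a n k ell \<beta> (expand s v g)"
  shows "E \<subseteq> range (translate s v)"
proof -
  have rec: "log_recurrence (up_symbol s n v) (down_symbol s n v) (layer g)"
    using sol hypergeometric_solution_expand_iff[OF v] by blast
  obtain m0 where m0: "\<forall>m\<le>m0. layer g m = 0" using layers_bounded_below by blast
  obtain m where m: "log_length (layer g m) = N" using degree_layers(1)[OF g(1)] g(2) by auto
  have "N \<le> (\<Sum>i\<in>{m0..<m}. order 0 (up_symbol s n v i))"
    using log_recurrence_length_le[OF rec up_symbol_nonzero, of m0 m] m m0 by simp
  then have "card factor_positions \<le> card (\<Union>i\<in>{m0..<m}. vanishing_factors s n v i)"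
    by (simp only: sum_order_up_symbol card_factor_positions)
  then have "(\<Union>i\<in>{m0..<m}. vanishing_factors s n v i) = factor_positions"
    by (intro card_seteq UN_vanishing_factors_subset) simp_all
  then have "(\<Union>i. vanishing_factors s n v i) = factor_positions"
    using UN_vanishing_factors_subset[of v UNIV] by blast
  then show ?thesis using all_factors_vanish_iff[OF v] by blast
qed

text \<open>
  The maximal solution of the recurrence that starts before the first vanishing factor has
  coefficients of length \<open>N\<close> after the last one. Differentiating it with respect to \<open>log x\<^sub>0\<close> lowers
  the length to the desired value.
\<close>

lemma ex_solution_of_degree:
  assumes v: "lies_over a n \<beta> v" and not_int: "\<And>j. j \<in> {k+1..n} \<Longrightarrow> v j \<notin> \<int>"
    and E: "E \<subseteq> range (translate s v)" and \<mu>: "\<mu> < N"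
  shows "\<exists>g. g \<noteq> 0 \<and> degree g = \<mu> \<and> hypergeometric_solution a n k ell \<beta> (expand s v g)"
proof -
  have all: "(\<Union>m. vanishing_factors s n v m) = factor_positions"
    using E all_factors_vanish_iff[OF v] by blast
  then have "\<forall>x\<in>factor_positions. \<exists>m. x \<in> vanishing_factors s n v m" by blast
  then obtain f where f: "\<And>x. x \<in> factor_positions \<Longrightarrow> x \<in> vanishing_factors s n v (f x)"
    by metis
  define m0 where "m0 = Min (insert 0 (f ` factor_positions))"
  define m1 where "m1 = Max (insert 0 (f ` factor_positions)) + 1"
  have bounds: "f x \<in> {m0..<m1}" if "x \<in> factor_positions" for x
  proof -
    have "f x \<in> insert 0 (f ` factor_positions)" using that by blast
    moreover have "finite (insert 0 (f ` factor_positions))" by simp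
    ultimately have "m0 \<le> f x" "f x \<le> m1 - 1"
      unfolding m0_def m1_def using Min_le Max_ge by (blast, force)
    then show ?thesis by simp
  qed
  have UN: "(\<Union>i\<in>{m0..<m1}. vanishing_factors s n v i) = factor_positions"
    using f bounds UN_vanishing_factors_subset[of v "{m0..<m1}"] by blast
  have unit: "coeff (down_symbol s n v m) 0 \<noteq> 0" for m
  proof (rule down_symbol_unit)
    fix j assume "j \<in> {1..n}" "s j < 0"
    then have "j \<in> {k+1..n}" by (auto simp: signed_def split: if_splits)
    then show "v j \<notin> \<int>" by (rule not_int)
  qed
  obtain c where rec: "log_recurrence (up_symbol s n v) (down_symbol s n v) c"
    and low: "\<forall>m\<le>m0. c m = 0"
    and len: "\<And>m. log_length (c m) = card (\<Union>i\<in>{m0..<m}. vanishing_factors s n v i)"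
    using ex_log_recurrence_solution[of "up_symbol s n v" "down_symbol s n v" m0, OF up_symbol_nonzero unit]
    unfolding sum_order_up_symbol by blast
  have len_le: "log_length (c m) \<le> N" for m
    unfolding len card_factor_positions[symmetric]
    by (intro card_mono UN_vanishing_factors_subset) simp
  have len_m1: "log_length (c m1) = N"
    by (simp only: len UN card_factor_positions)
  define c' where "c' m = (pderiv ^^ (N - Suc \<mu>)) (c m)" for m
  have len': "log_length (c' m) = log_length (c m) - (N - Suc \<mu>)" for m
    by (simp add: c'_def log_length_pderiv_funpow)
  have len'_le: "log_length (c' m) \<le> Suc \<mu>" for m
    using len'[of m] len_le[of m] \<mu> by linarith
  have len'_m1: "log_length (c' m1) = Suc \<mu>"
    using len'[of m1] len_m1 \<mu> by linarith
  have "c' m = 0" if "m \<le> m0" for m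
    using that low by (simp add: c'_def)
  then obtain g where g: "layer g = c'"
    using ex_layers[of m0 c' "Suc \<mu>"] len'_le by blast
  have "g \<noteq> 0"
  proof
    assume "g = 0"
    then have "c' m1 = 0" by (simp add: g[symmetric] layer_def)
    with len'_m1 show False by simp
  qed
  moreover have "degree g = \<mu>"
    using degree_layers[OF \<open>g \<noteq> 0\<close>] len'_le len'_m1 g by (metis Suc_le_mono antisym)
  moreover have "hypergeometric_solution a n k ell \<beta> (expand s v g)"
    unfolding hypergeometric_solution_expand_iff[OF v] g c'_def
    by (rule log_recurrence_pderiv_funpow[OF rec])
  ultimately show ?thesis by blast
qed

lemma is_singleton_exponents'_iff:
  "is_singleton E' \<longleftrightarrow> (\<exists>v\<in>E'. E \<subseteq> range (translate s v))"
proof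
  assume "is_singleton E'"
  then obtain v where v: "E' = {v}" by (auto simp: is_singleton_def)
  have "u \<in> range (translate s v)" if u: "u \<in> E" for u
  proof -
    from ex_translate_exponents'[OF u] v obtain m where "translate s u m = v" by blast
    then have "u = translate s v (- m)" by (auto simp: translate_def)
    then show ?thesis by blast
  qed
  with v show "\<exists>v\<in>E'. E \<subseteq> range (translate s v)" by blast
next
  assume "\<exists>v\<in>E'. E \<subseteq> range (translate s v)"
  then obtain v where v: "v \<in> E'" and E: "E \<subseteq> range (translate s v)" by blast
  have "u = v" if u: "u \<in> E'" for u
  proof -
    from u E obtain m where m: "u = translate s v m" by (auto simp: exponents'_def)
    with exponents'_translate_unique[OF v] u have "m = 0" by blast
    with m show ?thesis by (simp add: translate_def)
  qed
  with v have "E' = {v}" by blast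
  then show "is_singleton E'" by simp
qed

end

text \<open>
  By the hypothesis on the volume, the numbers \<open>\<mu>\<close> in question are those below \<open>N\<close>. A solution for
  the largest one forces all exponents into one class, and a single class provides solutions for
  all of them.
\<close>

theorem theorem9p1:
  fixes a :: "nat \<Rightarrow> int ^ 'd" and n k :: nat and ell :: "nat \<Rightarrow> nat" and \<beta> :: "complex ^ 'd"
  assumes "dim (real_span a n) = n - 1"
    and "\<And>S. S \<subseteq> pts a n \<Longrightarrow> card S = n - 1 \<Longrightarrow> independent S"
    and "1 \<le> k" and "k \<le> n"
    and "\<And>j. j \<in> {1..n} \<Longrightarrow> ell j > 0"
    and "Gcd (ell ` {1..n}) = 1"
    and "relations a n = rel_lattice n k ell"
    and "vol a n = real (\<Sum>i\<in>{1..k}. ell i)"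
    and "\<beta> \<in> complex_span a n"
    and "nonresonant a n k \<beta>"
  shows "maximal_unipotent_monodromy a n k ell \<beta> \<longleftrightarrow> is_singleton (exponents' a n k ell \<beta>)"
proof -
  interpret one_relation_parameter a n k ell \<beta>
    using assms by unfold_locales auto
  have "ell 1 \<le> N" using k by (intro member_le_sum) auto
  then have "N > 0" using ell_pos[of 1] k by simp
  then have vol: "real \<mu> \<le> vol a n - 1 \<longleftrightarrow> \<mu> < N" for \<mu>
    unfolding assms(8) by linarith
  have over: "lies_over a n \<beta> v" if "v \<in> E'" for v
    using that by (auto simp: exponents'_def exponents_iff)
  have "maximal_unipotent_monodromy a n k ell \<beta> \<longleftrightarrow> (\<exists>v\<in>E'. E \<subseteq> range (translate s v))"
    unfolding maximal_unipotent_monodromy_def vol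
  proof (intro bex_cong refl iffI)
    fix v assume v: "v \<in> E'" and sol: "\<forall>\<mu><N. \<exists>g. g \<noteq> 0 \<and> degree g = \<mu> \<and>
        hypergeometric_solution a n k ell \<beta> (expand s v g)"
    then obtain g where "g \<noteq> 0" "degree g = N - 1"
      "hypergeometric_solution a n k ell \<beta> (expand s v g)"
      using \<open>N > 0\<close> by (metis diff_less zero_less_one)
    then show "E \<subseteq> range (translate s v)"
      using solution_of_maximal_degree_imp[OF over[OF v]] \<open>N > 0\<close> by simp
  next
    fix v assume v: "v \<in> E'" and E: "E \<subseteq> range (translate s v)"
    obtain i b where i: "i \<in> {1..k}" "v i = of_nat b"
      using v by (auto simp: exponents'_def exponents_iff)
    then have "v j \<notin> \<int>" if "j \<in> {k+1..n}" for j
      using nonresonant_not_int[OF assms(10) over[OF v], of i j] that by simp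
    then show "\<forall>\<mu><N. \<exists>g. g \<noteq> 0 \<and> degree g = \<mu> \<and>
        hypergeometric_solution a n k ell \<beta> (expand s v g)"
      using ex_solution_of_degree[OF over[OF v] _ E] by blast
  qed
  then show ?thesis using is_singleton_exponents'_iff by simp
qed

end
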